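(* Let $\varphi\in SN$ have the Baire property or be measurable, with $\varphi$ eventually bounded away from $0$ and $1/\varphi$ locally integrable, and let $f:\mathbb{R}\to(0,\infty)$ be measurable and $\varphi$-regularly varying. Then there are $\rho\in\mathbb{R}$, a measurable function $d(\cdot)$ with $d(x)\to d\in(0,\infty)$ as $x\to\infty$, and a continuous function $e(\cdot)$ with $e(x)\to0$ as $x\to\infty$, such that $$f(x)=d(x)\exp\left(\rho\int_1^x\frac{du}{\varphi(u)}+\int_0^x e(v)\,dv\right)=d(x)\exp\left(\rho\int_1^x\frac{u}{\varphi(u)}\frac{du}{u}+\int_0^x e(v)\,dv\right),$$ where for each $t\in\mathbb{R}$ $$\int_x^{x+t\varphi(x)}e(v)\,dv=o(1)\quad\text{as }x\to\infty.$$
   Context: A function $\varphi:\mathbb{R}\to(0,\infty)$ is self-neglecting, written $\varphi\in SN$, if $\varphi(x+t\varphi(x))/\varphi(x)\to 1$ as $x\to\infty$, locally uniformly in $t\in\mathbb{R}$. "Eventually bounded away from $0$" means there are $K>0$ and $X$ with $\varphi(x)\ge K$ for all $x\ge X$. For $\varphi\in SN$, a measurable function $f:\mathbb{R}\to(0,\infty)$ is $\varphi$-regularly varying if for some function $g$, $f(x+t\varphi(x))/f(x)\to g(t)$ as $x\to\infty$ for every $t\in\mathbb{R}$, where $g$ is non-zero, i.e. $g>0$ on a set that is not Lebesgue null. *)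

theory Defs
  imports "HOL-Analysis.Analysis"
begin

definition nowhere_dense :: "'a::topological_space set \<Rightarrow> bool" where
  "nowhere_dense A \<longleftrightarrow> interior (closure A) = {}"

definition meagre :: "'a::topological_space set \<Rightarrow> bool" where
  "meagre A \<longleftrightarrow> (\<exists>N :: nat \<Rightarrow> 'a set. (\<forall>n. nowhere_dense (N n)) \<and> A = (\<Union>n. N n))"

definition baire_set :: "'a::topological_space set \<Rightarrow> bool" where
  "baire_set A \<longleftrightarrow> (\<exists>U. open U \<and> meagre ((A - U) \<union> (U - A)))"

definition baire_function :: "('a::topological_space \<Rightarrow> 'b::topological_space) \<Rightarrow> bool" where
  "baire_function f \<longleftrightarrow> (\<forall>V. open V \<longrightarrow> baire_set (f -` V))"

(* On the real line, locally uniform convergence is uniform convergence on compact sets. *)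
definition self_neglecting :: "(real \<Rightarrow> real) \<Rightarrow> bool" where
  "self_neglecting \<phi> \<longleftrightarrow>
     (\<forall>x. \<phi> x > 0) \<and>
     (\<forall>K. compact K \<longrightarrow>
        uniform_limit K (\<lambda>x t. \<phi> (x + t * \<phi> x) / \<phi> x) (\<lambda>_. 1) at_top)"

(* Lebesgue (not merely Borel) measurability is meant, so all integrals are over the
   completed measure lebesgue. *)
definition locally_integrable :: "(real \<Rightarrow> real) \<Rightarrow> bool" where
  "locally_integrable h \<longleftrightarrow> (\<forall>K. compact K \<longrightarrow> set_integrable lebesgue K h)"

definition eventually_bounded_away_from_0 :: "(real \<Rightarrow> real) \<Rightarrow> bool" where
  "eventually_bounded_away_from_0 \<phi> \<longleftrightarrow> (\<exists>K>0. \<exists>X. \<forall>x\<ge>X. \<phi> x \<ge> K)"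

definition regularly_varying_wrt :: "(real \<Rightarrow> real) \<Rightarrow> (real \<Rightarrow> real) \<Rightarrow> bool" where
  "regularly_varying_wrt \<phi> f \<longleftrightarrow>
     (\<exists>g :: real \<Rightarrow> real.
        (\<forall>t. ((\<lambda>x. f (x + t * \<phi> x) / f x) \<longlongrightarrow> g t) at_top) \<and>
        {t. g t > 0} \<notin> null_sets lebesgue)"

(* The integral from a to b, with the sign reversed if b < a. *)
abbreviation oriented_integral :: "real \<Rightarrow> real \<Rightarrow> (real \<Rightarrow> real) \<Rightarrow> real" where
  "oriented_integral a b h \<equiv> interval_lebesgue_integral lebesgue (ereal a) (ereal b) h"

end

(*
  Write h = ln f. Egorov-type exhaustion on a compact set of positive measure shows that the
  increments h (x + t * phi x) - h x are locally bounded in t, so f (x + t * phi x) / f x has a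
  positive limit for every t. Averaging the cocycle identity of the increments over t then upgrades
  pointwise to locally uniform convergence, and makes the limit additive, hence of the form rho * t.
  As phi is nearly constant on {x..x + t * phi x}, the function H = h - rho * \<integral> 1 / phi has
  increments tending to 0; since phi is bounded below, so do H (x + w) - H x for w in {0..1}.
  Interpolating H between the natural numbers gives e.
*)
theory Submission
  imports Defs
begin

section \<open>Overlap of a large set with its almost-identical affine images\<close>

text \<open>For constant \<open>\<phi>\<close> the increments satisfy a plain cocycle identity; in
  general a change of base point from \<open>x\<close> to \<open>y\<close> also rescales the
  argument by \<open>\<phi> x / \<phi> y\<close>, a ratio that tends to 1 without being equal to 1.
  Hence the overlap argument has to admit affine maps and not only translations, and additivity of
  the limit cannot be read off pointwise: the rescaled argument moves with \<open>x\<close>, which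
  calls for uniform convergence and a continuous limit beforehand. Every average is over
  \<open>t\<close> at a fixed base point, where an increment is an affine reparametrisation of
  \<open>h\<close> plus a constant and so measurable in \<open>t\<close>. Positivity of
  \<open>g\<close> is given on a non-null set only; bounds on the logarithmic increments spread it
  to all \<open>t\<close>, since they keep the quotients above some \<open>exp (- M)\<close>.
  Finally, \<open>e\<close> has to be continuous although \<open>H\<close> is merely measurable, so
  \<open>e\<close> is built from the values of \<open>H\<close> at natural numbers alone, and
  \<open>d\<close> absorbs the remainder exactly.\<close>

lemma compact_subset_of_positive_measure:
  fixes A :: "'a::euclidean_space set"
  assumes A: "A \<in> sets lebesgue" "A \<notin> null_sets lebesgue"
  obtains C where "compact C" "C \<subseteq> A" "measure lebesgue C > 0"
proof -
  have "A = (\<Union>n::nat. A \<inter> cball 0 (real n))"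
    by (auto intro: real_arch_simple)
  then obtain n :: nat where n: "A \<inter> cball 0 (real n) \<notin> null_sets lebesgue"
    using A(2) by (metis null_sets_UN)
  define A' where "A' = A \<inter> cball 0 (real n)"
  have A': "A' \<in> lmeasurable"
    unfolding A'_def by (rule bounded_set_imp_lmeasurable) (use A(1) in \<open>auto intro!: bounded_Int\<close>)
  have pos: "measure lebesgue A' > 0"
    using n A' unfolding A'_def[symmetric]
    by (metis measure_nonneg less_eq_real_def negligible_iff_measure0 negligible_iff_null_sets)
  \<comment> \<open>A defect smaller than the measure of \<open>A'\<close> itself is enough: it
    leaves \<open>T\<close> with positive measure.\<close>
  obtain T where T: "closed T" "T \<subseteq> A'" "A' - T \<in> lmeasurable"
      "emeasure lebesgue (A' - T) < ennreal (measure lebesgue A')"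
    using sets_lebesgue_inner_closed[of A' "measure lebesgue A'"] A' pos by blast
  have "compact T"
    using T(1,2) unfolding A'_def compact_eq_bounded_closed
    by (meson bounded_cball bounded_subset le_inf_iff)
  moreover have "T \<in> lmeasurable"
    using \<open>compact T\<close> lmeasurable_compact by blast
  moreover have "measure lebesgue (A' - T) < measure lebesgue A'"
    using T(3,4) by (simp add: emeasure_eq_measure2 ennreal_less_iff)
  moreover have "measure lebesgue (A' - T) = measure lebesgue A' - measure lebesgue T"
    using T(2) A' calculation(2) by (simp add: measurable_measure_Diff)
  ultimately show thesis
    using that[of T] T(2) unfolding A'_def by auto
qed

text \<open>
  A compact set of positive measure fills most of some open neighbourhood. Almost-identical affine
  maps keep it in that neighbourhood and almost preserve measure, so a large subset must meet its
  own image.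
\<close>

lemma affine_image_meets_large_subset:
  fixes C :: "real set"
  assumes C: "compact C" "measure lebesgue C > 0"
  obtains \<delta> where "\<delta> > 0"
    "\<And>B u r. \<lbrakk>B \<in> sets lebesgue; B \<subseteq> C; measure lebesgue B > 9/10 * measure lebesgue C;
        \<bar>u\<bar> \<le> \<delta>; \<bar>r - 1\<bar> \<le> \<delta>\<rbrakk> \<Longrightarrow> \<exists>s\<in>B. \<exists>t\<in>B. s = u + r * t"
proof -
  have Cl: "C \<in> lmeasurable" using C(1) lmeasurable_compact by blast
  \<comment> \<open>If \<open>B\<close> and its image were disjoint, their union inside
    \<open>U\<close> would have measure above 19/10 * 9/10 = 1.71 times that of \<open>C\<close>,
    whereas this choice keeps \<open>U\<close> below 1.1 times.\<close>
  obtain U where U: "open U" "C \<subseteq> U" "U - C \<in> lmeasurable"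
      "emeasure lebesgue (U - C) < ennreal (measure lebesgue C / 10)"
    using sets_lebesgue_outer_open[of C "measure lebesgue C / 10"] Cl C(2)
    by (metis divide_pos_pos fmeasurableD zero_less_numeral)
  have UC: "U = C \<union> (U - C)" using U(2) by auto
  have Ul: "U \<in> lmeasurable"
    using UC Cl U(3) by (metis fmeasurable.Un)
  have "measure lebesgue U \<le> measure lebesgue C + measure lebesgue (U - C)"
    using UC Cl U(3) by (metis fmeasurableD measure_Un_le)
  also have "measure lebesgue (U - C) < measure lebesgue C / 10"
    using U(3,4) C(2) by (simp add: emeasure_eq_measure2 ennreal_less_iff)
  finally have Um: "measure lebesgue U < 11/10 * measure lebesgue C" by simp
  obtain \<epsilon> where \<epsilon>: "\<epsilon> > 0" "\<And>x y. x \<in> C \<Longrightarrow> dist x y < \<epsilon> \<Longrightarrow> y \<in> U"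
  proof (cases "U = UNIV")
    case False
    have "\<exists>d>0. \<forall>x\<in>C. \<forall>y\<in>-U. d \<le> dist x y"
      using U(1,2) C(1) by (intro separate_compact_closed) auto
    then show ?thesis using that by (metis ComplI not_less)
  qed (use that[of 1] in auto)
  obtain R where R: "R > 0" "\<And>x. x \<in> C \<Longrightarrow> \<bar>x\<bar> \<le> R"
    using compact_imp_bounded[OF C(1)] by (auto simp: bounded_pos)
  \<comment> \<open>A point \<open>t\<close> of \<open>C\<close> moves by at most \<open>\<bar>r -
    1\<bar> * \<bar>t\<bar> + \<bar>u\<bar> \<le> \<delta> * (1 + R)\<close>, which has to stay
    below \<open>\<epsilon>\<close>; the bound 1/10 gives \<open>r \<ge> 9/10\<close>.\<close>
  define \<delta> where "\<delta> = min (1/10) (\<epsilon> / (2 * (1 + R)))"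
  have \<delta>: "\<delta> > 0" "\<delta> \<le> 1/10" "\<delta> * (1 + R) < \<epsilon>"
  proof -
    show "\<delta> > 0" using \<epsilon>(1) R(1) by (auto simp: \<delta>_def)
    show "\<delta> \<le> 1/10" unfolding \<delta>_def by (rule min.cobounded1)
    have "\<delta> * (1 + R) \<le> \<epsilon> / (2 * (1 + R)) * (1 + R)"
      using R(1) by (intro mult_right_mono) (auto simp: \<delta>_def)
    also have "\<dots> = \<epsilon> / 2" using R(1) by (simp add: field_simps)
    finally show "\<delta> * (1 + R) < \<epsilon>" using \<epsilon>(1) by simp
  qed
  show thesis
  proof (rule that[OF \<delta>(1)], rule ccontr)
    fix B u r
    assume B: "B \<in> sets lebesgue" "B \<subseteq> C" "measure lebesgue B > 9/10 * measure lebesgue C"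
      and ur: "\<bar>u\<bar> \<le> \<delta>" "\<bar>r - 1\<bar> \<le> \<delta>" and no: "\<not> (\<exists>s\<in>B. \<exists>t\<in>B. s = u + r * t)"
    define B' where "B' = (\<lambda>t. r *\<^sub>R t + u) ` B"
    have Bl: "B \<in> lmeasurable"
      using fmeasurableI2[OF Cl B(2) B(1)] .
    have r: "r \<ge> 9/10" using ur(2) \<delta>(2) by linarith
    have B'm: "measure lebesgue B' = \<bar>r\<bar> * measure lebesgue B"
      unfolding B'_def using measure_lebesgue_affine[of r u B] by simp
    also have "\<dots> > 0" using r B(3) C(2) by (intro mult_pos_pos) auto
    \<comment> \<open>\<open>measure\<close> defaults to 0 on non-measurable sets and on sets of
      infinite measure, so its positivity alone puts \<open>B'\<close> into
      \<open>lmeasurable\<close>.\<close>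
    finally have B'l: "B' \<in> lmeasurable"
      by (metis fmeasurableI measure_notin_sets enn2real_top infinity_ennreal_def less_irrefl less_top measure_def)
    have "B' \<subseteq> U"
    proof
      fix y assume "y \<in> B'"
      then obtain t where t: "t \<in> B" "y = r * t + u" unfolding B'_def by auto
      have "t \<in> C" using t(1) B(2) by auto
      have "dist t y = \<bar>(r - 1) * t + u\<bar>" by (simp add: t(2) dist_real_def algebra_simps)
      also have "\<dots> \<le> \<bar>r - 1\<bar> * \<bar>t\<bar> + \<bar>u\<bar>" by (metis abs_mult abs_triangle_ineq)
      also have "\<dots> \<le> \<delta> * R + \<delta>"
        using R(2)[OF \<open>t \<in> C\<close>] ur \<delta>(1) by (intro add_mono mult_mono) auto
      also have "\<dots> < \<epsilon>" using \<delta>(3) by (simp add: algebra_simps)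
      finally show "y \<in> U" using \<epsilon>(2) \<open>t \<in> C\<close> by blast
    qed
    have "B \<inter> B' = {}" using no unfolding B'_def by (auto simp: add.commute)
    then have "measure lebesgue (B \<union> B') = measure lebesgue B + measure lebesgue B'"
      using Bl B'l by (simp add: measure_Un3)
    also have "\<dots> \<ge> measure lebesgue B + 9/10 * measure lebesgue B"
      unfolding B'm using r by (intro add_left_mono mult_right_mono) auto
    finally have "19/10 * measure lebesgue B \<le> measure lebesgue (B \<union> B')" by simp
    also have "\<dots> \<le> measure lebesgue U"
      using \<open>B' \<subseteq> U\<close> B(2) U(2) Bl B'l Ul by (intro measure_mono_fmeasurable) auto
    finally show False using Um B(3) C(2) by linarith
  qed
qed

section \<open>Self-neglecting functions\<close>

locale self_neglecting_function =
  fixes \<phi> :: "real \<Rightarrow> real"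
  assumes self_neglecting: "self_neglecting \<phi>"
begin

lemma pos [simp]: "\<phi> x > 0"
  using self_neglecting by (simp add: self_neglecting_def)

lemma nonzero [simp]: "\<phi> x \<noteq> 0"
  using pos[of x] by linarith

lemma ratio_uniform:
  assumes "\<epsilon> > 0"
  shows "\<forall>\<^sub>F x in at_top. \<forall>t\<in>{-T..T}. \<bar>\<phi> (x + t * \<phi> x) / \<phi> x - 1\<bar> < \<epsilon>"
proof -
  have "uniform_limit {-T..T} (\<lambda>x t. \<phi> (x + t * \<phi> x) / \<phi> x) (\<lambda>_. 1) at_top"
    using self_neglecting by (simp add: self_neglecting_def)
  from uniform_limitD[OF this assms] show ?thesis by (simp add: dist_real_def)
qed

lemma ratio_inverse_uniform:
  assumes "\<epsilon> > 0"
  shows "\<forall>\<^sub>F x in at_top. \<forall>t\<in>{-T..T}. \<bar>\<phi> x / \<phi> (x + t * \<phi> x) - 1\<bar> < \<epsilon>"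
proof -
  \<comment> \<open>With the ratio \<open>q\<close> kept above 1/2, inversion at most doubles the
    error.\<close>
  define \<eta> where "\<eta> = min (1/2) (\<epsilon>/2)"
  have \<eta>: "\<eta> > 0" "\<eta> \<le> 1/2" "\<eta> \<le> \<epsilon>/2" using assms by (auto simp: \<eta>_def)
  show ?thesis
    using ratio_uniform[OF \<eta>(1), of T]
  proof eventually_elim
    case (elim x)
    show ?case
    proof
      fix t assume "t \<in> {-T..T}"
      define q where "q = \<phi> (x + t * \<phi> x) / \<phi> x"
      have q: "\<bar>q - 1\<bar> < \<eta>" using elim \<open>t \<in> _\<close> by (auto simp: q_def)
      then have q2: "q > 1/2" using \<eta>(2) by linarith
      have "\<bar>1 / q - 1\<bar> = \<bar>q - 1\<bar> / q" using q2 by (simp add: field_simps abs_if)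
      also have "\<dots> < \<eta> / q" using q q2 by (intro divide_strict_right_mono) auto
      also have "\<dots> \<le> \<eta> / (1/2)" using q2 \<eta>(1) by (intro divide_left_mono) auto
      also have "\<dots> \<le> \<epsilon>" using \<eta>(3) by simp
      finally show "\<bar>\<phi> x / \<phi> (x + t * \<phi> x) - 1\<bar> < \<epsilon>" by (simp add: q_def)
    qed
  qed
qed

text \<open>If \<open>\<phi> x \<ge> x / T\<close> then \<open>x + t * \<phi> x = 0\<close> for some \<open>t \<in> {-T..T}\<close>, which forces
  \<open>\<phi> x\<close> to be comparable to \<open>\<phi> 0\<close>.\<close>

lemma sublinear:
  assumes "T > 0"
  shows "\<forall>\<^sub>F x in at_top. T * \<phi> x < x"
  using ratio_uniform[of "1/2" T, simplified] eventually_gt_at_top[of "2 * T * \<phi> 0"]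
proof eventually_elim
  case (elim x)
  show ?case
  proof (rule ccontr)
    assume "\<not> T * \<phi> x < x"
    then have x: "x \<le> T * \<phi> x" by simp
    moreover have "T * \<phi> x > 0" using assms by simp
    moreover have "x > 0" using elim(2) assms by (intro le_less_trans[OF _ elim(2)]) (simp add: less_imp_le)
    ultimately have "- (x / \<phi> x) \<in> {-T..T}"
      by (auto simp: field_simps)
    from elim(1)[rule_format, OF this] have "\<bar>\<phi> 0 / \<phi> x - 1\<bar> < 1/2" by simp
    then have "\<phi> x < 2 * \<phi> 0" by (simp add: abs_if field_simps split: if_splits)
    then have "T * \<phi> x \<le> T * (2 * \<phi> 0)" using assms by (intro mult_left_mono) auto
    then show False using x elim(2) by (simp add: mult_ac)
  qed
qed

text \<open>By sublinearity the points \<open>x + t * \<phi> x\<close> stay above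
  \<open>x / 2\<close> uniformly in \<open>t\<close>, so whatever holds far out survives such a
  change of base point.\<close>

lemma eventually_shift:
  assumes "\<forall>\<^sub>F x in at_top. P x"
  shows "\<forall>\<^sub>F x in at_top. \<forall>t\<in>{-T..T}. P (x + t * \<phi> x)"
proof -
  obtain N where N: "\<And>x. x \<ge> N \<Longrightarrow> P x"
    using assms by (auto simp: eventually_at_top_linorder)
  have "2 * max T 1 > 0" by simp
  from sublinear[OF this] eventually_ge_at_top[of "2 * N"]
  show ?thesis
  proof eventually_elim
    case (elim x)
    show ?case
    proof
      fix t assume t: "t \<in> {-T..T}"
      have "- max T 1 * \<phi> x \<le> t * \<phi> x" using t by (intro mult_right_mono) (auto intro: less_imp_le)
      then show "P (x + t * \<phi> x)" using elim by (intro N) (simp add: mult_ac)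
    qed
  qed
qed

end

section \<open>Local boundedness of increments\<close>

lemma borel_measurable_lebesgue_affine:
  fixes h :: "real \<Rightarrow> 'a::topological_space"
  assumes "h \<in> borel_measurable lebesgue" "c \<noteq> 0"
  shows "(\<lambda>t. h (a + c * t)) \<in> borel_measurable lebesgue"
proof -
  have "(\<lambda>t. a + c * t) \<in> lebesgue \<rightarrow>\<^sub>M lebesgue"
    using lebesgue_affine_measurable[where c = "\<lambda>x::real. c"] assms(2) by simp
  from measurable_compose[OF this assms(1)] show ?thesis .
qed

context self_neglecting_function
begin

definition incr :: "(real \<Rightarrow> real) \<Rightarrow> real \<Rightarrow> real \<Rightarrow> real" where
  "incr h x t = h (x + t * \<phi> x) - h x"

text \<open>The path from \<open>x\<close> to \<open>x + s * \<phi> x\<close> is cut at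
  \<open>y = x + u * \<phi> x\<close>; the second leg, a displacement by
  \<open>(s - u) * \<phi> x\<close>, is re-expressed in units of \<open>\<phi> y\<close>.\<close>

lemma incr_cocycle:
  "incr h x s = incr h x u + incr h (x + u * \<phi> x) ((s - u) * (\<phi> x / \<phi> (x + u * \<phi> x)))"
proof -
  have "(s - u) * (\<phi> x / \<phi> (x + u * \<phi> x)) * \<phi> (x + u * \<phi> x) = (s - u) * \<phi> x"
    by simp
  then have "x + u * \<phi> x + (s - u) * (\<phi> x / \<phi> (x + u * \<phi> x)) * \<phi> (x + u * \<phi> x) = x + s * \<phi> x"
    by (metis add.assoc add.commute diff_add_cancel distrib_right)
  then show ?thesis by (simp only: incr_def)
qed

lemma borel_measurable_incr:
  assumes "h \<in> borel_measurable lebesgue"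
  shows "incr h x \<in> borel_measurable lebesgue"
  using borel_measurable_lebesgue_affine[OF assms, of "\<phi> x" x]
  unfolding incr_def by (auto simp: mult.commute)

lemma ratio_inverse_tendsto:
  assumes "filterlim x at_top sequentially" "\<And>n. u n \<in> {-T..T}"
  shows "(\<lambda>n. \<phi> (x n) / \<phi> (x n + u n * \<phi> (x n))) \<longlonglongrightarrow> 1"
proof (rule tendstoI)
  fix \<epsilon> :: real assume "\<epsilon> > 0"
  from eventually_compose_filterlim[OF ratio_inverse_uniform[OF this, of T] assms(1)]
  show "\<forall>\<^sub>F n in sequentially. dist (\<phi> (x n) / \<phi> (x n + u n * \<phi> (x n))) 1 < \<epsilon>"
    by eventually_elim (use assms(2) in \<open>auto simp: dist_real_def\<close>)
qed

lemma shift_at_top: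
  assumes "filterlim x at_top sequentially" "\<And>n. u n \<in> {-T..T}"
  shows "filterlim (\<lambda>n. x n + u n * \<phi> (x n)) at_top sequentially"
  unfolding filterlim_at_top
proof
  fix Z :: real
  from eventually_compose_filterlim[OF eventually_shift[OF eventually_ge_at_top[of Z], of T] assms(1)]
  show "\<forall>\<^sub>F n in sequentially. Z \<le> x n + u n * \<phi> (x n)"
    by eventually_elim (use assms(2) in auto)
qed

text \<open>
  If increments \<open>incr h (x n) (u n)\<close> blew up, write \<open>y n = x n + u n * \<phi> (x n)\<close>. On a large subset
  of a compact set both \<open>incr h (x n)\<close> and \<open>incr h (y n)\<close> are bounded uniformly in \<open>n\<close>, and the
  overlap lemma yields \<open>s\<close>, \<open>t\<close> in that subset with \<open>x n + s * \<phi> (x n) = y n + t * \<phi> (y n)\<close>.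
\<close>

lemma incr_bounded_near_0:
  assumes h: "h \<in> borel_measurable lebesgue"
    and A: "A \<in> sets lebesgue" "A \<notin> null_sets lebesgue"
    and lim: "\<And>t. t \<in> A \<Longrightarrow> ((\<lambda>x. incr h x t) \<longlongrightarrow> \<gamma> t) at_top"
  obtains \<delta> M where "\<delta> > 0" "\<forall>\<^sub>F x in at_top. \<forall>u\<in>{-\<delta>..\<delta>}. \<bar>incr h x u\<bar> \<le> M"
proof -
  obtain C where C: "compact C" "C \<subseteq> A" "measure lebesgue C > 0"
    using compact_subset_of_positive_measure[OF A] by blast
  obtain \<delta> where \<delta>: "\<delta> > 0"
    "\<And>B u r. \<lbrakk>B \<in> sets lebesgue; B \<subseteq> C; measure lebesgue B > 9/10 * measure lebesgue C;
        \<bar>u\<bar> \<le> \<delta>; \<bar>r - 1\<bar> \<le> \<delta>\<rbrakk> \<Longrightarrow> \<exists>s\<in>B. \<exists>t\<in>B. s = u + r * t"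
    using affine_image_meets_large_subset[OF C(1,3)] by metis
  have "\<exists>M. \<forall>\<^sub>F x in at_top. \<forall>u\<in>{-\<delta>..\<delta>}. \<bar>incr h x u\<bar> \<le> M"
  proof (rule ccontr)
    assume "\<not> ?thesis"
    then have "\<forall>n::nat. \<exists>x u. x \<ge> real n \<and> u \<in> {-\<delta>..\<delta>} \<and> \<bar>incr h x u\<bar> > real n"
      unfolding eventually_at_top_linorder by (metis not_le)
    then obtain x u where xu: "\<And>n::nat. x n \<ge> real n" "\<And>n. u n \<in> {-\<delta>..\<delta>}"
        "\<And>n::nat. \<bar>incr h (x n) (u n)\<bar> > real n"
      by metis
    define y where "y n = x n + u n * \<phi> (x n)" for n
    have xlim: "filterlim x at_top sequentially"
      by (rule filterlim_at_top_mono[OF filterlim_real_sequentially]) (use xu(1) in auto)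
    have ylim: "filterlim y at_top sequentially"
      unfolding y_def by (rule shift_at_top[OF xlim xu(2)])
    \<comment> \<open>For fixed \<open>t\<close> both sequences of increments converge and are
      therefore bounded, so these sets increase to \<open>C\<close> and one of them exceeds 9/10 of
      its measure.\<close>
    define B where "B N = {t \<in> C. \<forall>n. \<bar>incr h (x n) t\<bar> \<le> real N \<and> \<bar>incr h (y n) t\<bar> \<le> real N}"
      for N :: nat
    have "C \<in> sets lebesgue" using C(1) by (simp add: lmeasurable_compact fmeasurableD)
    have Bm: "B N \<in> sets lebesgue" for N
    proof -
      have "B N = C \<inter> (\<Inter>n. {t \<in> space lebesgue. \<bar>incr h (x n) t\<bar> \<le> real N}
          \<inter> {t \<in> space lebesgue. \<bar>incr h (y n) t\<bar> \<le> real N})"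
        by (auto simp: B_def)
      moreover have "{t \<in> space lebesgue. \<bar>incr h z t\<bar> \<le> real N} \<in> sets lebesgue" for z
        using borel_measurable_incr[OF h, of z] by measurable
      ultimately show ?thesis using \<open>C \<in> sets lebesgue\<close> by auto
    qed
    have BC: "(\<Union>N. B N) = C"
    proof
      show "C \<subseteq> (\<Union>N. B N)"
      proof
        fix t assume "t \<in> C"
        then have t: "((\<lambda>x. incr h x t) \<longlongrightarrow> \<gamma> t) at_top" using lim C(2) by auto
        have "Bseq (\<lambda>n. incr h (x n) t)" "Bseq (\<lambda>n. incr h (y n) t)"
          using filterlim_compose[OF t xlim] filterlim_compose[OF t ylim]
          by (auto intro!: convergent_imp_Bseq simp: convergent_def)
        then obtain K L where KL: "\<And>n. \<bar>incr h (x n) t\<bar> \<le> K" "\<And>n. \<bar>incr h (y n) t\<bar> \<le> L"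
          by (auto simp: Bseq_def)
        obtain N :: nat where "max K L \<le> real N" using real_arch_simple by blast
        then have "t \<in> B N"
          using KL \<open>t \<in> C\<close> unfolding B_def by (auto intro: order_trans)
        then show "t \<in> (\<Union>N. B N)" by blast
      qed
    qed (auto simp: B_def)
    have "(\<lambda>N. measure lebesgue (B N)) \<longlonglongrightarrow> measure lebesgue (\<Union>N. B N)"
    proof (rule Lim_measure_incseq)
      show "incseq B" 
        by (rule incseq_SucI) (auto simp: B_def intro: order_trans[of _ "real _"])
      show "emeasure lebesgue (\<Union>N. B N) \<noteq> \<infinity>"
        using lmeasurable_compact[OF C(1)] unfolding BC by (auto simp: fmeasurable_def)
    qed (use Bm in auto)
    moreover have "9/10 * measure lebesgue C < measure lebesgue (\<Union>N. B N)"
      using C(3) BC by simp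
    ultimately have "\<forall>\<^sub>F N in sequentially. 9/10 * measure lebesgue C < measure lebesgue (B N)"
      by (rule order_tendstoD(1))
    then obtain N where N: "9/10 * measure lebesgue C < measure lebesgue (B N)"
      by (auto simp: eventually_sequentially)
    have "(\<lambda>n. \<phi> (x n) / \<phi> (y n)) \<longlonglongrightarrow> 1"
      unfolding y_def by (rule ratio_inverse_tendsto[OF xlim xu(2)])
    then have "(\<lambda>n. inverse (\<phi> (x n) / \<phi> (y n))) \<longlonglongrightarrow> inverse 1"
      by (rule tendsto_inverse) simp
    then have "(\<lambda>n. \<phi> (y n) / \<phi> (x n)) \<longlonglongrightarrow> 1" by (simp add: divide_simps)
    then have "\<forall>\<^sub>F n in sequentially. dist (\<phi> (y n) / \<phi> (x n)) 1 < \<delta>"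
      using \<delta>(1) by (rule tendstoD)
    \<comment> \<open>The index goes beyond \<open>2 * N\<close> because a difference of two
      increments bounded by \<open>N\<close> has to contradict a value larger than
      \<open>n\<close>.\<close>
    then have "\<forall>\<^sub>F n in sequentially. \<bar>\<phi> (y n) / \<phi> (x n) - 1\<bar> \<le> \<delta> \<and> n \<ge> 2 * N"
      using eventually_ge_at_top[of "2 * N"] by eventually_elim (auto simp: dist_real_def)
    then obtain n where n: "\<bar>\<phi> (y n) / \<phi> (x n) - 1\<bar> \<le> \<delta>" "n \<ge> 2 * N"
      by (auto simp: eventually_sequentially)
    have "\<bar>u n\<bar> \<le> \<delta>" using xu(2)[of n] by auto
    have "B N \<subseteq> C" by (auto simp: B_def)
    from \<delta>(2)[OF Bm this N \<open>\<bar>u n\<bar> \<le> \<delta>\<close> n(1)]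
    obtain s t where st: "s \<in> B N" "t \<in> B N" "s = u n + \<phi> (y n) / \<phi> (x n) * t" by blast
    have "(s - u n) * (\<phi> (x n) / \<phi> (y n)) = t" by (simp add: st(3))
    then have "incr h (x n) (u n) = incr h (x n) s - incr h (y n) t"
      using incr_cocycle[of h "x n" s "u n"] by (simp add: y_def)
    moreover have "\<bar>incr h (x n) s\<bar> \<le> real N" "\<bar>incr h (y n) t\<bar> \<le> real N"
      using st(1,2) by (auto simp: B_def)
    ultimately have "\<bar>incr h (x n) (u n)\<bar> \<le> real (2 * N)" by simp
    also have "\<dots> \<le> real n" using n(2) by (simp only: of_nat_le_iff)
    finally show False using xu(3)[of n] by simp
  qed
  then show thesis using that \<delta>(1) by blast
qed

text \<open>A first step of \<open>2/3 * u\<close> stays in the known window \<open>{-S..S}\<close>,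
  and so does the remaining third after rescaling by a ratio of at most 2, since
  \<open>1/3 * (3/2 * S) * 2 = S\<close>. Each round widens the window by the factor 3/2 and doubles
  the bound; finitely many rounds reach \<open>T\<close>.\<close>

lemma incr_locally_bounded:
  assumes h: "h \<in> borel_measurable lebesgue"
    and A: "A \<in> sets lebesgue" "A \<notin> null_sets lebesgue"
    and lim: "\<And>t. t \<in> A \<Longrightarrow> ((\<lambda>x. incr h x t) \<longlongrightarrow> \<gamma> t) at_top"
  obtains M where "\<forall>\<^sub>F x in at_top. \<forall>u\<in>{-T..T}. \<bar>incr h x u\<bar> \<le> M"
proof -
  obtain \<delta> M where \<delta>: "\<delta> > 0" and M: "\<forall>\<^sub>F x in at_top. \<forall>u\<in>{-\<delta>..\<delta>}. \<bar>incr h x u\<bar> \<le> M"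
    by (rule incr_bounded_near_0[OF h A lim])
  have step: "\<exists>M. \<forall>\<^sub>F x in at_top. \<forall>u\<in>{-((3/2)^n * \<delta>)..(3/2)^n * \<delta>}. \<bar>incr h x u\<bar> \<le> M" for n
  proof (induction n)
    case (Suc n)
    define S where "S = (3/2)^n * \<delta>"
    obtain M where M: "\<forall>\<^sub>F x in at_top. \<forall>u\<in>{-S..S}. \<bar>incr h x u\<bar> \<le> M"
      using Suc by (auto simp: S_def)
    have "\<forall>\<^sub>F x in at_top. \<forall>u\<in>{-(3/2*S)..3/2*S}. \<bar>incr h x u\<bar> \<le> 2 * M"
      using M eventually_shift[OF M, of S] ratio_inverse_uniform[OF zero_less_one, of S]
    proof eventually_elim
      case (elim x)
      show ?case
      proof
        fix u assume u: "u \<in> {-(3/2*S)..3/2*S}"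
        define v where "v = 2/3 * u"
        define r where "r = \<phi> x / \<phi> (x + v * \<phi> x)"
        have v: "v \<in> {-S..S}" using u by (auto simp: v_def)
        have "\<bar>r - 1\<bar> < 1" using elim(3) v unfolding r_def by blast
        then have r: "0 < r" "r \<le> 2" by auto
        have "\<bar>(u - v) * r\<bar> = 1/3 * \<bar>u\<bar> * r" using r(1) by (simp add: v_def abs_mult)
        also have "\<dots> \<le> 1/3 * (3/2 * S) * 2" using u r by (intro mult_mono) auto
        finally have "(u - v) * r \<in> {-S..S}" by auto
        then have "\<bar>incr h (x + v * \<phi> x) ((u - v) * r)\<bar> \<le> M" "\<bar>incr h x v\<bar> \<le> M"
          using elim(1,2) v by auto
        then show "\<bar>incr h x u\<bar> \<le> 2 * M"
          using incr_cocycle[of h x u v] by (simp add: r_def)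
      qed
    qed
    then show ?case by (auto simp: S_def mult_ac)
  qed (use M in auto)
  obtain n where "(3/2)^n > T / \<delta>"
    using real_arch_pow[of "3/2"] by auto
  then have n: "(3/2)^n * \<delta> \<ge> T" using \<delta> by (simp add: field_simps)
  obtain M where "\<forall>\<^sub>F x in at_top. \<forall>u\<in>{-((3/2)^n * \<delta>)..(3/2)^n * \<delta>}. \<bar>incr h x u\<bar> \<le> M"
    using step by blast
  then have "\<forall>\<^sub>F x in at_top. \<forall>u\<in>{-T..T}. \<bar>incr h x u\<bar> \<le> M"
    by eventually_elim (use n in auto)
  then show thesis using that by blast
qed

end

section \<open>Uniform convergence of increments\<close>

lemma absolutely_integrable_on_bounded:
  fixes f :: "real \<Rightarrow> real"
  assumes "f \<in> borel_measurable lebesgue" "\<And>x. x \<in> {a..b} \<Longrightarrow> \<bar>f x\<bar> \<le> M"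
  shows "f absolutely_integrable_on {a..b}"
proof (rule measurable_bounded_by_integrable_imp_absolutely_integrable)
  show "f \<in> borel_measurable (lebesgue_on {a..b})"
    using assms(1) by (rule measurable_restrict_space1)
  show "norm (f x) \<le> M" if "x \<in> {a..b}" for x
    using assms(2)[OF that] by simp
qed auto

lemma has_integral_affine_unit_interval:
  fixes f :: "real \<Rightarrow> real"
  assumes "f integrable_on {u..u + r}" "r > 0"
  shows "((\<lambda>t. f (u + r * t)) has_integral integral {u..u + r} f / r) {0..1}"
proof -
  have "(\<lambda>x. (1 / r) *\<^sub>R x + - ((1 / r) *\<^sub>R u)) ` cbox u (u + r) = {0..1}"
    using assms(2) image_affinity_atLeastAtMost[of "1/r" "- (u/r)" u "u + r"]
    by (auto simp: field_simps)
  moreover have "(f has_integral integral {u..u + r} f) (cbox u (u + r))"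
    using integrable_integral[OF assms(1)] by simp
  from has_integral_affinity[OF this, of r u] assms(2)
  have "((\<lambda>t. f (r * t + u)) has_integral integral {u..u + r} f / r)
      ((\<lambda>x. (1 / r) *\<^sub>R x + - ((1 / r) *\<^sub>R u)) ` cbox u (u + r))"
    by simp
  ultimately show ?thesis by (simp add: add.commute)
qed

lemma integral_diff_le:
  fixes f :: "real \<Rightarrow> real"
  assumes f: "f integrable_on {-R..R}" and M: "\<And>x. x \<in> {-R..R} \<Longrightarrow> \<bar>f x\<bar> \<le> M"
    and ab: "a \<in> {-R..R}" "b \<in> {-R..R}"
  shows "\<bar>integral {-R..a} f - integral {-R..b} f\<bar> \<le> M * \<bar>a - b\<bar>"
proof -
  have *: "\<bar>integral {-R..a} f - integral {-R..b} f\<bar> \<le> M * (a - b)"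
    if "b \<le> a" "a \<le> R" "-R \<le> b" for a b
  proof -
    have "integral {-R..b} f + integral {b..a} f = integral {-R..a} f"
      using that by (intro Henstock_Kurzweil_Integration.integral_combine
          integrable_on_subinterval[OF f]) auto
    moreover have "norm (integral {b..a} f) \<le> M * measure lborel (cbox b a)"
    proof (rule has_integral_bound)
      have "f integrable_on {b..a}" by (rule integrable_on_subinterval[OF f]) (use that in auto)
      then show "(f has_integral integral {b..a} f) (cbox b a)" by (simp add: integrable_integral)
      show "M \<ge> 0" using M[of a] that by auto
    qed (use M that in auto)
    ultimately show ?thesis using that by simp
  qed
  show ?thesis
    using *[of a b] *[of b a] ab by (cases "b \<le> a") (auto simp: abs_minus_commute)
qed

text \<open>Subtracting the linear part leaves an additive \<open>p\<close> that vanishes at the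
  integers, hence has period 1 and is bounded on the whole line. As
  \<open>p (n * t) = n * p t\<close> for natural \<open>n\<close>, a nonzero value would break the
  bound.\<close>

lemma additive_locally_bounded_imp_linear:
  fixes \<gamma> :: "real \<Rightarrow> real"
  assumes add: "\<And>s t. \<gamma> (s + t) = \<gamma> s + \<gamma> t" and bound: "\<And>t. t \<in> {0..1} \<Longrightarrow> \<bar>\<gamma> t\<bar> \<le> M"
  shows "\<gamma> t = \<gamma> 1 * t"
proof -
  define p where "p t = \<gamma> t - \<gamma> 1 * t" for t
  interpret p: additive p
    by unfold_locales (simp add: p_def add algebra_simps)
  have nat: "p (real n * t) = real n * p t" for n t
    by (induction n) (simp_all add: p.zero p.add distrib_right)
  have "p 1 = 0" by (simp add: p_def)
  then have nat0: "p (real n) = 0" for n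
    using nat[of n 1] by simp
  have int0: "p (of_int z) = 0" for z
    by (cases z rule: int_cases2) (simp_all add: nat0 p.minus)
  have pb: "\<bar>p t\<bar> \<le> M + \<bar>\<gamma> 1\<bar>" for t
  proof -
    have "p t = p (frac t)"
      using p.diff[of t "of_int \<lfloor>t\<rfloor>"] int0 by (simp add: frac_def)
    moreover have "frac t \<in> {0..1}" by (simp add: frac_lt_1 less_imp_le)
    then have "\<bar>\<gamma> (frac t)\<bar> \<le> M" "\<bar>\<gamma> 1 * frac t\<bar> \<le> \<bar>\<gamma> 1\<bar>"
      using bound by (auto simp: abs_mult mult_left_le)
    then have "\<bar>p (frac t)\<bar> \<le> M + \<bar>\<gamma> 1\<bar>" unfolding p_def by linarith
    ultimately show ?thesis by simp
  qed
  have "p t = 0"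
  proof (rule ccontr)
    assume "p t \<noteq> 0"
    then obtain n :: nat where "real n * \<bar>p t\<bar> > M + \<bar>\<gamma> 1\<bar>"
      using reals_Archimedean3[of "\<bar>p t\<bar>"] by auto
    then show False using pb[of "real n * t"] by (simp add: nat abs_mult)
  qed
  then show ?thesis by (simp add: p_def)
qed

section \<open>From pointwise to locally uniform convergence, and linearity of the limit\<close>

locale convergent_increments = self_neglecting_function +
  fixes h \<gamma> :: "real \<Rightarrow> real"
  assumes h_measurable: "h \<in> borel_measurable lebesgue"
    and incr_tendsto: "((\<lambda>x. incr h x t) \<longlongrightarrow> \<gamma> t) at_top"
begin

lemma limit_measurable: "\<gamma> \<in> borel_measurable lebesgue"
proof (rule borel_measurable_LIMSEQ_real)
  show "(\<lambda>n. incr h (real n) t) \<longlonglongrightarrow> \<gamma> t" for t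
    using filterlim_compose[OF incr_tendsto filterlim_real_sequentially] .
qed (rule borel_measurable_incr[OF h_measurable])

text \<open>Convergence holds at every \<open>t\<close> here, so the whole line serves as the
  non-null set; the bound on the increments then passes to their limit.\<close>

lemma incr_and_limit_bounded:
  obtains M where "M > 0" "\<forall>u\<in>{-T..T}. \<bar>\<gamma> u\<bar> \<le> M"
    "\<forall>\<^sub>F x in at_top. \<forall>u\<in>{-T..T}. \<bar>incr h x u\<bar> \<le> M"
proof -
  have "UNIV \<notin> null_sets (lebesgue :: real measure)" by (auto simp: null_sets_def)
  then obtain M where M: "\<forall>\<^sub>F x in at_top. \<forall>u\<in>{-T..T}. \<bar>incr h x u\<bar> \<le> M"
    using incr_locally_bounded[OF h_measurable _ _ incr_tendsto, of UNIV T] by auto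
  have "\<bar>\<gamma> u\<bar> \<le> max M 1" if "u \<in> {-T..T}" for u
  proof (rule tendsto_upperbound[OF tendsto_rabs[OF incr_tendsto]])
    show "\<forall>\<^sub>F x in at_top. \<bar>incr h x u\<bar> \<le> max M 1"
      using M by eventually_elim (use that in \<open>auto intro: max.coboundedI1\<close>)
  qed simp
  moreover have "\<forall>\<^sub>F x in at_top. \<forall>u\<in>{-T..T}. \<bar>incr h x u\<bar> \<le> max M 1"
    using M by eventually_elim (auto intro: max.coboundedI1)
  ultimately show thesis using that[of "max M 1"] by simp
qed

lemma limit_absolutely_integrable: "\<gamma> absolutely_integrable_on {a..b}"
proof -
  define R where "R = max \<bar>a\<bar> \<bar>b\<bar>"
  obtain M where M: "M > 0" "\<forall>u\<in>{-R..R}. \<bar>\<gamma> u\<bar> \<le> M"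
    "\<forall>\<^sub>F x in at_top. \<forall>u\<in>{-R..R}. \<bar>incr h x u\<bar> \<le> M"
    by (rule incr_and_limit_bounded[of R])
  from M(2) have "\<gamma> absolutely_integrable_on {-R..R}"
    by (intro absolutely_integrable_on_bounded[OF limit_measurable, of _ _ M]) blast
  then show ?thesis
    by (rule absolutely_integrable_on_subinterval) (auto simp: R_def)
qed

text \<open>Only for large \<open>x\<close>: a measurable \<open>h\<close> may be unbounded on
  bounded intervals, while the increments are bounded far out.\<close>

lemma incr_absolutely_integrable:
  "\<forall>\<^sub>F x in at_top. incr h x absolutely_integrable_on {-R..R}"
proof -
  obtain M where M: "M > 0" "\<forall>u\<in>{-R..R}. \<bar>\<gamma> u\<bar> \<le> M"
    "\<forall>\<^sub>F x in at_top. \<forall>u\<in>{-R..R}. \<bar>incr h x u\<bar> \<le> M"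
    by (rule incr_and_limit_bounded[of R])
  from M(3) show ?thesis
    by eventually_elim
      (metis absolutely_integrable_on_bounded borel_measurable_incr h_measurable)
qed

text \<open>The unnormalised L1 distance on a symmetric window. It dominates the error of the
  integral over every subinterval at once, which is where uniformity in \<open>u\<close> comes
  from.\<close>

definition mean_error :: "real \<Rightarrow> real \<Rightarrow> real" where
  "mean_error R x = integral {-R..R} (\<lambda>s. \<bar>incr h x s - \<gamma> s\<bar>)"

lemma error_absolutely_integrable:
  assumes "incr h x absolutely_integrable_on {-R..R}"
  shows "(\<lambda>s. \<bar>incr h x s - \<gamma> s\<bar>) absolutely_integrable_on {-R..R}"
  using absolutely_integrable_norm[OF set_integral_diff(1)[OF assms limit_absolutely_integrable]]
  by (simp add: o_def)

text \<open>Dominated convergence: increments and limit are both bounded by \<open>M\<close> on the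
  window, so the constant \<open>2 * M\<close> dominates their difference there.\<close>

lemma mean_error_tendsto: "(mean_error R \<longlongrightarrow> 0) at_top"
proof -
  obtain M where M: "M > 0" "\<forall>u\<in>{-R..R}. \<bar>\<gamma> u\<bar> \<le> M"
    "\<forall>\<^sub>F x in at_top. \<forall>u\<in>{-R..R}. \<bar>incr h x u\<bar> \<le> M"
    by (rule incr_and_limit_bounded[of R])
  have "((\<lambda>x. LINT s|lebesgue. indicator {-R..R} s *\<^sub>R \<bar>incr h x s - \<gamma> s\<bar>)
      \<longlongrightarrow> (LINT s|(lebesgue :: real measure). 0)) at_top"
  proof (rule integral_dominated_convergence_at_top)
    show "integrable lebesgue (\<lambda>s. indicator {-R..R} s *\<^sub>R (2 * M))"
      using absolutely_integrable_continuous_real[OF continuous_on_const, of "-R" R "2 * M"]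
      by (simp only: set_integrable_def)
    show "\<forall>\<^sub>F x in at_top. AE s in lebesgue.
        norm (indicator {-R..R} s *\<^sub>R \<bar>incr h x s - \<gamma> s\<bar>) \<le> indicator {-R..R} s *\<^sub>R (2 * M)"
      using M(3)
    proof eventually_elim
      case (elim x)
      have "\<bar>incr h x s - \<gamma> s\<bar> \<le> 2 * M" if "s \<in> {-R..R}" for s
        using elim[rule_format, OF that] M(2)[rule_format, OF that] by linarith
      then show ?case by (auto simp: indicator_def)
    qed
    have "((\<lambda>x. indicator {-R..R} s *\<^sub>R \<bar>incr h x s - \<gamma> s\<bar>) \<longlongrightarrow> indicator {-R..R} s *\<^sub>R \<bar>\<gamma> s - \<gamma> s\<bar>) at_top"
      for s by (intro tendsto_intros incr_tendsto)
    then show "AE s in lebesgue. ((\<lambda>x. indicator {-R..R} s *\<^sub>R \<bar>incr h x s - \<gamma> s\<bar>) \<longlongrightarrow> 0) at_top"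
      by simp
    show "(\<lambda>s. indicator {-R..R} s *\<^sub>R \<bar>incr h x s - \<gamma> s\<bar>) \<in> borel_measurable lebesgue" for x
      by (intro borel_measurable_scaleR borel_measurable_indicator borel_measurable_abs
          borel_measurable_diff borel_measurable_incr h_measurable limit_measurable) simp
  qed simp
  moreover have "\<forall>\<^sub>F x in at_top.
      (LINT s|lebesgue. indicator {-R..R} s *\<^sub>R \<bar>incr h x s - \<gamma> s\<bar>) = mean_error R x"
    using incr_absolutely_integrable[of R]
  proof eventually_elim
    case (elim x)
    from set_lebesgue_integral_eq_integral(2)[OF error_absolutely_integrable[OF elim]]
    show ?case by (simp add: set_lebesgue_integral_def mean_error_def)
  qed
  ultimately show ?thesis by (simp add: tendsto_cong)
qed

lemma integral_error_le:
  assumes "incr h x absolutely_integrable_on {-R..R}" "-R \<le> a" "b \<le> R"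
  shows "\<bar>integral {a..b} (incr h x) - integral {a..b} \<gamma>\<bar> \<le> mean_error R x"
proof -
  have sub: "{a..b} \<subseteq> {-R..R}" using assms by auto
  note i1 = set_lebesgue_integral_eq_integral(1)[OF
      absolutely_integrable_on_subinterval[OF assms(1) sub]]
  note i2 = set_lebesgue_integral_eq_integral(1)[OF limit_absolutely_integrable[of a b]]
  note E = error_absolutely_integrable[OF assms(1)]
  note i3 = set_lebesgue_integral_eq_integral(1)[OF absolutely_integrable_on_subinterval[OF E sub]]
  have "\<bar>integral {a..b} (\<lambda>s. incr h x s - \<gamma> s)\<bar> \<le> integral {a..b} (\<lambda>s. \<bar>incr h x s - \<gamma> s\<bar>)"
    using Henstock_Kurzweil_Integration.integral_norm_bound_integral[OF integrable_diff[OF i1 i2] i3]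
    by simp
  also have "\<dots> \<le> mean_error R x"
    unfolding mean_error_def
    by (rule integral_subset_le[OF sub i3 set_lebesgue_integral_eq_integral(1)[OF E]]) simp
  finally show ?thesis
    using Henstock_Kurzweil_Integration.integral_diff[OF i1 i2] by simp
qed

text \<open>
  With \<open>y = x + u * \<phi> x\<close> and \<open>r = \<phi> y / \<phi> x\<close> the cocycle identity reads
  \<open>incr h x u = incr h x (u + r * t) - incr h y t\<close> for every \<open>t\<close>; averaging over \<open>t \<in> {0..1}\<close> turns
  the pointwise convergence of increments into uniform convergence.
\<close>

lemma incr_uniform_average:
  assumes "\<epsilon> > 0" "T > 0"
  shows "\<forall>\<^sub>F x in at_top. \<forall>u\<in>{-T..T}.
    \<bar>incr h x u - (integral {u..u + 1} \<gamma> - integral {0..1} \<gamma>)\<bar> < \<epsilon>"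
proof -
  \<comment> \<open>The window has to contain \<open>{0..1}\<close>, \<open>{u..u + 1}\<close> and
    \<open>{u..u + r}\<close> for \<open>u \<in> {-T..T}\<close> and
    \<open>r \<le> 3/2\<close>.\<close>
  define R where "R = T + 3"
  obtain M where M: "M > 0" "\<forall>u\<in>{-R..R}. \<bar>\<gamma> u\<bar> \<le> M"
    "\<forall>\<^sub>F x in at_top. \<forall>u\<in>{-R..R}. \<bar>incr h x u\<bar> \<le> M"
    by (rule incr_and_limit_bounded[of R])
  \<comment> \<open>The value 1/2 keeps \<open>r\<close> between 1/2 and 3/2; the other term limits
    the cost \<open>2 * M * \<eta>\<close> of replacing \<open>r\<close> by 1 to
    \<open>\<epsilon> / 4\<close>.\<close>
  define \<eta> where "\<eta> = min (1/2) (\<epsilon> / (8 * M))"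
  have \<eta>: "\<eta> > 0" "\<eta> \<le> 1/2" "2 * M * \<eta> \<le> \<epsilon> / 4"
  proof -
    show "\<eta> > 0" "\<eta> \<le> 1/2" using assms M(1) unfolding \<eta>_def by (auto intro: min.cobounded1)
    have "2 * M * \<eta> \<le> 2 * M * (\<epsilon> / (8 * M))"
      using M(1) by (intro mult_left_mono) (auto simp: \<eta>_def)
    then show "2 * M * \<eta> \<le> \<epsilon> / 4" using M(1) by simp
  qed
  have \<gamma>i: "\<gamma> integrable_on {a..b}" for a b
    using set_lebesgue_integral_eq_integral(1)[OF limit_absolutely_integrable] .
  have small: "\<forall>\<^sub>F x in at_top. mean_error S x < \<epsilon> / 8" for S
    using assms(1) by (intro order_tendstoD(2)[OF mean_error_tendsto]) simp
  \<comment> \<open>Stated as one predicate of the base point, so that it can be used at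
    \<open>x\<close> and, after a shift, at \<open>x + u * \<phi> x\<close>.\<close>
  have near: "\<forall>\<^sub>F x in at_top. incr h x absolutely_integrable_on {-R..R} \<and> mean_error R x < \<epsilon> / 8"
    using incr_absolutely_integrable small by (rule eventually_conj)
  show ?thesis
    using near eventually_shift[OF near, of T] ratio_uniform[OF \<eta>(1), of T]
  proof eventually_elim
    case (elim x)
    show ?case
    proof
      fix u assume u: "u \<in> {-T..T}"
      define y where "y = x + u * \<phi> x"
      define r where "r = \<phi> y / \<phi> x"
      have xi: "incr h x absolutely_integrable_on {-R..R}" and yi: "incr h y absolutely_integrable_on {-R..R}"
        and ex: "mean_error R x < \<epsilon> / 8" and ey: "mean_error R y < \<epsilon> / 8"
        using elim(1,2) u by (auto simp: y_def)
      have r: "\<bar>r - 1\<bar> < \<eta>" using elim(3) u by (auto simp: r_def y_def)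
      then have r12: "1/2 \<le> r" "r \<le> 3/2" using \<eta>(2) by linarith+
      have "((\<lambda>t. incr h x (u + r * t)) has_integral integral {u..u + r} (incr h x) / r) {0..1}"
      proof (rule has_integral_affine_unit_interval)
        have "incr h x absolutely_integrable_on {u..u + r}"
          by (rule absolutely_integrable_on_subinterval[OF xi]) (use u r12 in \<open>auto simp: R_def\<close>)
        then show "incr h x integrable_on {u..u + r}"
          by (rule set_lebesgue_integral_eq_integral(1))
      qed (use r12 in simp)
      moreover have "(incr h y has_integral integral {0..1} (incr h y)) {0..1}"
      proof (rule integrable_integral)
        have "incr h y absolutely_integrable_on {0..1}"
          by (rule absolutely_integrable_on_subinterval[OF yi]) (use assms(2) in \<open>auto simp: R_def\<close>)
        then show "incr h y integrable_on {0..1}"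
          by (rule set_lebesgue_integral_eq_integral(1))
      qed
      ultimately have "((\<lambda>t. incr h x (u + r * t) - incr h y t) has_integral
          integral {u..u + r} (incr h x) / r - integral {0..1} (incr h y)) {0..1}"
        by (rule has_integral_diff)
      moreover have "incr h x (u + r * t) - incr h y t = incr h x u" for t
      proof -
        have "(u + r * t - u) * (\<phi> x / \<phi> y) = t" by (simp add: r_def)
        then show ?thesis using incr_cocycle[of h x "u + r * t" u] by (simp add: y_def)
      qed
      ultimately have "((\<lambda>t::real. incr h x u) has_integral
          integral {u..u + r} (incr h x) / r - integral {0..1} (incr h y)) {0..1}"
        by simp
      then have avg: "incr h x u = integral {u..u + r} (incr h x) / r - integral {0..1} (incr h y)"
        using has_integral_unique[OF _ has_integral_const_real[of "incr h x u" 0 1]] by fastforce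
      have "\<bar>integral {u..u + r} (incr h x) / r - integral {u..u + r} \<gamma> / r\<bar>
          = \<bar>integral {u..u + r} (incr h x) - integral {u..u + r} \<gamma>\<bar> / r"
        using r12 by (simp add: abs_mult diff_divide_distrib[symmetric])
      also have "\<dots> \<le> mean_error R x / r"
        using u r12 by (intro divide_right_mono integral_error_le[OF xi]) (auto simp: R_def)
      also have "\<dots> \<le> 2 * mean_error R x"
      proof -
        have "mean_error R x \<ge> 0" using integral_error_le[OF xi, of 0 0] assms(2) by (simp add: R_def)
        then have "mean_error R x / r \<le> mean_error R x / (1/2)"
          using r12 by (intro divide_left_mono) auto
        then show ?thesis by simp
      qed
      finally have b1: "\<bar>integral {u..u + r} (incr h x) / r - integral {u..u + r} \<gamma> / r\<bar> < \<epsilon> / 4"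
        using ex by simp
      have b3: "\<bar>integral {0..1} (incr h y) - integral {0..1} \<gamma>\<bar> < \<epsilon> / 8"
        using integral_error_le[OF yi, of 0 1] ey assms(2) by (simp add: R_def)
      define W where "W a = integral {-R..a} \<gamma>" for a
      have comb: "integral {a..b} \<gamma> = W b - W a" if "-R \<le> a" "a \<le> b" for a b
        using Henstock_Kurzweil_Integration.integral_combine[OF that \<gamma>i] by (simp add: W_def)
      have lip: "\<bar>W a - W b\<bar> \<le> M * \<bar>a - b\<bar>" if "a \<in> {-R..R}" "b \<in> {-R..R}" for a b
        unfolding W_def by (rule integral_diff_le[OF \<gamma>i M(2)[rule_format] that])
      \<comment> \<open>Two corrections, each costing at most \<open>M * \<bar>r - 1\<bar>\<close>:
        the endpoint moves from \<open>u + r\<close> to \<open>u + 1\<close>, and the factor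
        \<open>1 / r\<close> becomes 1.\<close>
      have "integral {u..u + r} \<gamma> / r - integral {u..u + 1} \<gamma>
          = (W (u + r) - W (u + 1)) + (1 - r) / r * (W (u + r) - W u)"
        using r12 u by (subst (1 2) comb) (auto simp: R_def field_simps)
      also have "\<bar>\<dots>\<bar> \<le> \<bar>W (u + r) - W (u + 1)\<bar> + \<bar>(1 - r) / r * (W (u + r) - W u)\<bar>"
        by (rule abs_triangle_ineq)
      also have "\<dots> \<le> M * \<bar>r - 1\<bar> + \<bar>(1 - r) / r\<bar> * (M * r)"
      proof (rule add_mono)
        show "\<bar>W (u + r) - W (u + 1)\<bar> \<le> M * \<bar>r - 1\<bar>"
          using lip[of "u + r" "u + 1"] u r12 by (auto simp: R_def)
        have "\<bar>W (u + r) - W u\<bar> \<le> M * r"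
          using lip[of "u + r" u] u r12 by (auto simp: R_def)
        then show "\<bar>(1 - r) / r * (W (u + r) - W u)\<bar> \<le> \<bar>(1 - r) / r\<bar> * (M * r)"
          unfolding abs_mult by (rule mult_left_mono) simp
      qed
      also have "\<dots> = 2 * M * \<bar>r - 1\<bar>" using r12 by (simp add: abs_mult abs_minus_commute)
      also have "\<dots> \<le> 2 * M * \<eta>" using M(1) r by (intro mult_left_mono) auto
      finally have b2: "\<bar>integral {u..u + r} \<gamma> / r - integral {u..u + 1} \<gamma>\<bar> \<le> \<epsilon> / 4"
        using \<eta>(3) by simp
      show "\<bar>incr h x u - (integral {u..u + 1} \<gamma> - integral {0..1} \<gamma>)\<bar> < \<epsilon>"
        using avg b1 b2 b3 assms(1) by linarith
    qed
  qed
qed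

text \<open>Uniqueness of limits. The formula lets the uniform estimate be stated against
  \<open>\<gamma>\<close> and exhibits \<open>\<gamma>\<close> through its own primitive, which
  makes it continuous.\<close>

lemma limit_eq_average: "\<gamma> u = integral {u..u + 1} \<gamma> - integral {0..1} \<gamma>"
proof (rule tendsto_unique[OF _ incr_tendsto])
  show "((\<lambda>x. incr h x u) \<longlongrightarrow> integral {u..u + 1} \<gamma> - integral {0..1} \<gamma>) at_top"
  proof (rule tendstoI)
    fix \<epsilon> :: real assume "\<epsilon> > 0"
    have "\<bar>u\<bar> + 1 > 0" by simp
    from incr_uniform_average[OF \<open>\<epsilon> > 0\<close> this]
    show "\<forall>\<^sub>F x in at_top. dist (incr h x u) (integral {u..u + 1} \<gamma> - integral {0..1} \<gamma>) < \<epsilon>"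
    proof eventually_elim
      case (elim x)
      have "u \<in> {-(\<bar>u\<bar> + 1)..\<bar>u\<bar> + 1}" unfolding atLeastAtMost_iff by linarith
      from elim[rule_format, OF this] show ?case by (simp add: dist_real_def)
    qed
  qed
qed simp

lemma incr_uniform:
  assumes "\<epsilon> > 0"
  shows "\<forall>\<^sub>F x in at_top. \<forall>u\<in>{-T..T}. \<bar>incr h x u - \<gamma> u\<bar> < \<epsilon>"
proof -
  have *: "\<forall>\<^sub>F x in at_top. \<forall>u\<in>{-(max T 1)..max T 1}. \<bar>incr h x u - \<gamma> u\<bar> < \<epsilon>"
    using incr_uniform_average[OF assms, of "max T 1"]
    by (simp only: limit_eq_average[symmetric] less_max_iff_disj zero_less_one simp_thms)
  have "{-T..T} \<subseteq> {-(max T 1)..max T 1}" by (auto simp: max_def)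
  then show ?thesis by (intro eventually_mono[OF *]) blast
qed

lemma limit_isCont: "isCont \<gamma> t"
proof -
  define R where "R = \<bar>t\<bar> + 2"
  have "continuous_on {-R..R} (\<lambda>a. integral {-R..a} \<gamma>)"
    by (intro indefinite_integral_continuous_1
        set_lebesgue_integral_eq_integral(1)[OF limit_absolutely_integrable])
  then have W: "isCont (\<lambda>a. integral {-R..a} \<gamma>) a" if "a \<in> {-R<..<R}" for a
    by (rule continuous_on_interior) (use that in simp)
  have "isCont (\<lambda>a. integral {-R..a + 1} \<gamma>) t"
  proof (rule isCont_o2[where g = "\<lambda>a. integral {-R..a} \<gamma>"])
    show "isCont (\<lambda>a. a + 1) t" by simp
    show "isCont (\<lambda>a. integral {-R..a} \<gamma>) (t + 1)"
      by (rule W) (simp add: R_def, linarith)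
  qed
  moreover have "isCont (\<lambda>a. integral {-R..a} \<gamma>) t"
    by (rule W) (simp add: R_def, linarith)
  ultimately have "isCont (\<lambda>a. integral {-R..a + 1} \<gamma> - integral {-R..a} \<gamma> - integral {0..1} \<gamma>) t"
    by (intro isCont_diff continuous_const)
  moreover have "\<forall>\<^sub>F a in nhds t. integral {-R..a + 1} \<gamma> - integral {-R..a} \<gamma> - integral {0..1} \<gamma> = \<gamma> a"
  proof -
    have "\<forall>\<^sub>F a in nhds t. a \<in> {-R<..<R}"
      by (rule eventually_nhds_in_open) (simp, simp add: R_def, linarith)
    then show ?thesis
    proof eventually_elim
      case (elim a)
      have "integral {-R..a} \<gamma> + integral {a..a + 1} \<gamma> = integral {-R..a + 1} \<gamma>"
        using elim by (intro Henstock_Kurzweil_Integration.integral_combine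
            set_lebesgue_integral_eq_integral(1)[OF limit_absolutely_integrable]) auto
      then show ?case using limit_eq_average[of a] by simp
    qed
  qed
  ultimately show ?thesis by (simp add: isCont_cong)
qed

text \<open>In the cocycle identity the second argument \<open>\<tau> x\<close> depends on
  \<open>x\<close> and only tends to \<open>t\<close>. Uniform convergence at the shifted base point
  replaces the increment at \<open>\<tau> x\<close> by \<open>\<gamma> (\<tau> x)\<close>, and
  continuity of \<open>\<gamma>\<close> does the rest.\<close>

lemma limit_additive: "\<gamma> (s + t) = \<gamma> s + \<gamma> t"
proof -
  define \<tau> where "\<tau> x = t * (\<phi> x / \<phi> (x + s * \<phi> x))" for x
  have ratio: "((\<lambda>x. \<phi> x / \<phi> (x + s * \<phi> x)) \<longlongrightarrow> 1) at_top"
  proof (rule tendstoI)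
    fix \<epsilon> :: real assume "\<epsilon> > 0"
    from ratio_inverse_uniform[OF this, of "\<bar>s\<bar>"]
    show "\<forall>\<^sub>F x in at_top. dist (\<phi> x / \<phi> (x + s * \<phi> x)) 1 < \<epsilon>"
    proof eventually_elim
      case (elim x)
      have "s \<in> {-\<bar>s\<bar>..\<bar>s\<bar>}" unfolding atLeastAtMost_iff by linarith
      from elim[rule_format, OF this] show ?case by (simp add: dist_real_def)
    qed
  qed
  have \<tau>: "(\<tau> \<longlongrightarrow> t) at_top"
    unfolding \<tau>_def using tendsto_mult[OF tendsto_const[of t] ratio] by simp
  have "((\<lambda>x. incr h (x + s * \<phi> x) (\<tau> x) - \<gamma> (\<tau> x)) \<longlongrightarrow> 0) at_top"
  proof (rule tendstoI)
    fix \<epsilon> :: real assume "\<epsilon> > 0"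
    from eventually_shift[OF incr_uniform[OF this, of "\<bar>t\<bar> + 1"], of "\<bar>s\<bar>"] tendstoD[OF \<tau> zero_less_one]
    show "\<forall>\<^sub>F x in at_top. dist (incr h (x + s * \<phi> x) (\<tau> x) - \<gamma> (\<tau> x)) 0 < \<epsilon>"
    proof eventually_elim
      case (elim x)
      have "\<bar>\<tau> x - t\<bar> < 1" using elim(2) by (simp add: dist_real_def)
      then have \<tau>x: "\<tau> x \<in> {-(\<bar>t\<bar> + 1)..\<bar>t\<bar> + 1}" unfolding atLeastAtMost_iff by linarith
      have "s \<in> {-\<bar>s\<bar>..\<bar>s\<bar>}" unfolding atLeastAtMost_iff by linarith
      from elim(1)[rule_format, OF this \<tau>x] show ?case by (simp add: dist_real_def)
    qed
  qed
  moreover have "((\<lambda>x. \<gamma> (\<tau> x)) \<longlongrightarrow> \<gamma> t) at_top"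
    using isCont_tendsto_compose[OF limit_isCont \<tau>] .
  ultimately have "((\<lambda>x. incr h (x + s * \<phi> x) (\<tau> x) - \<gamma> (\<tau> x) + \<gamma> (\<tau> x)) \<longlongrightarrow> 0 + \<gamma> t) at_top"
    by (rule tendsto_add)
  then have "((\<lambda>x. incr h (x + s * \<phi> x) (\<tau> x)) \<longlongrightarrow> \<gamma> t) at_top" by simp
  from tendsto_add[OF incr_tendsto[of s] this]
  have "((\<lambda>x. incr h x (s + t)) \<longlongrightarrow> \<gamma> s + \<gamma> t) at_top"
    by (subst incr_cocycle[of h _ "s + t" s]) (simp add: \<tau>_def)
  then show ?thesis
    by (rule tendsto_unique[OF trivial_limit_at_top_linorder incr_tendsto])
qed

lemma limit_linear: "\<gamma> t = \<gamma> 1 * t"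
proof -
  obtain M where M: "M > 0" "\<forall>u\<in>{-1..1}. \<bar>\<gamma> u\<bar> \<le> M"
    "\<forall>\<^sub>F x in at_top. \<forall>u\<in>{-1..1}. \<bar>incr h x u\<bar> \<le> M"
    by (rule incr_and_limit_bounded[of 1])
  from M(2) show ?thesis
    by (intro additive_locally_bounded_imp_linear[where M = M] limit_additive) auto
qed

end

section \<open>Integral representation\<close>

lemma locally_integrable_interval:
  assumes "locally_integrable h"
  shows "h absolutely_integrable_on {a..b}" "h integrable_on {a..b}"
  using assms set_lebesgue_integral_eq_integral(1) by (auto simp: locally_integrable_def)

lemma oriented_integral_eq_integral:
  assumes "locally_integrable h" "a \<le> b"
  shows "oriented_integral a b h = integral {a..b} h"
proof -
  have "h absolutely_integrable_on {a<..<b}"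
    by (rule set_integrable_subset[OF locally_integrable_interval(1)[OF assms(1), of a b]]) auto
  from set_lebesgue_integral_eq_integral(2)[OF this] show ?thesis
    using assms(2) by (simp add: interval_lebesgue_integral_def integral_open_interval_real)
qed

text \<open>A common base point \<open>-R\<close> removes the case split on orientation, so that
  additivity and continuity reduce to facts about one primitive.\<close>

lemma oriented_integral_eq_diff:
  assumes h: "locally_integrable h" and ab: "a \<in> {-R..R}" "b \<in> {-R..R}"
  shows "oriented_integral a b h = integral {-R..b} h - integral {-R..a} h"
proof -
  have *: "oriented_integral a b h = integral {-R..b} h - integral {-R..a} h"
    if "-R \<le> a" "a \<le> b" for a b
    using Henstock_Kurzweil_Integration.integral_combine[OF that locally_integrable_interval(2)[OF h]]
    by (simp add: oriented_integral_eq_integral[OF h that(2)])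
  show ?thesis
  proof (cases "a \<le> b")
    case False
    then have "oriented_integral a b h = - oriented_integral b a h"
      by (simp add: interval_lebesgue_integral_def)
    then show ?thesis using *[of b a] ab False by simp
  qed (use * ab in simp)
qed

lemma oriented_integral_combine:
  assumes "locally_integrable h"
  shows "oriented_integral a b h + oriented_integral b c h = oriented_integral a c h"
proof -
  define R where "R = max \<bar>a\<bar> (max \<bar>b\<bar> \<bar>c\<bar>)"
  have "a \<in> {-R..R}" "b \<in> {-R..R}" "c \<in> {-R..R}"
    by (auto simp: R_def max_def)
  then show ?thesis by (simp add: oriented_integral_eq_diff[OF assms, where R = R])
qed

lemma isCont_oriented_integral:
  assumes "locally_integrable h"
  shows "isCont (\<lambda>x. oriented_integral a x h) x"
proof -
  define R where "R = max \<bar>a\<bar> \<bar>x\<bar> + 1"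
  have R: "a \<in> {-R..R}" "x \<in> {-R<..<R}"
    by (auto simp: R_def max_def)
  have "continuous_on {-R..R} (\<lambda>b. integral {-R..b} h - integral {-R..a} h)"
    by (intro continuous_intros indefinite_integral_continuous_1 locally_integrable_interval(2) assms)
  then have "continuous_on {-R..R} (\<lambda>b. oriented_integral a b h)"
    using R(1) by (subst continuous_on_cong[OF refl oriented_integral_eq_diff[OF assms]]) auto
  then show ?thesis
    by (rule continuous_on_interior) (use R(2) in simp)
qed

lemma oriented_integral_near_constant:
  assumes h: "locally_integrable h"
    and near: "\<And>v. v \<in> {min a b..max a b} \<Longrightarrow> \<bar>h v - k\<bar> \<le> \<epsilon>"
  shows "\<bar>oriented_integral a b h - k * (b - a)\<bar> \<le> \<epsilon> * \<bar>b - a\<bar>"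
proof -
  have *: "\<bar>integral {a..b} h - k * (b - a)\<bar> \<le> \<epsilon> * (b - a)"
    if "a \<le> b" "\<And>v. v \<in> {a..b} \<Longrightarrow> \<bar>h v - k\<bar> \<le> \<epsilon>" for a b
  proof -
    have "((\<lambda>v. h v - k) has_integral (integral {a..b} h - k * (b - a))) {a..b}"
      using has_integral_diff[OF integrable_integral[OF locally_integrable_interval(2)[OF h, of a b]]
          has_integral_const_real[of k a b]] that(1)
      by (simp add: mult.commute)
    moreover have "\<epsilon> \<ge> 0" using that(2)[of a] that(1) by auto
    ultimately show ?thesis
      using has_integral_bound[of \<epsilon> "\<lambda>v. h v - k" _ a b] that by simp
  qed
  note o = oriented_integral_eq_integral[OF h]
  show ?thesis
  proof (cases "a \<le> b")
    case True
    then show ?thesis using *[of a b] near o by (auto simp: min_def max_def)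
  next
    case False
    have "oriented_integral a b h = - oriented_integral b a h"
      using False by (simp add: interval_lebesgue_integral_def)
    then have "\<bar>oriented_integral a b h - k * (b - a)\<bar> = \<bar>integral {b..a} h - k * (a - b)\<bar>"
      using o False by (simp add: algebra_simps abs_if)
    also have "\<dots> \<le> \<epsilon> * (a - b)" using *[of b a] near False by (auto simp: min_def max_def)
    finally show ?thesis using False by simp
  qed
qed

lemma continuous_imp_locally_integrable:
  assumes "continuous_on UNIV h"
  shows "locally_integrable h"
  unfolding locally_integrable_def
proof (intro allI impI)
  fix K :: "real set" assume K: "compact K"
  obtain R where R: "\<forall>x\<in>K. \<bar>x\<bar> \<le> R"
    using compact_imp_bounded[OF K] unfolding bounded_iff real_norm_def by blast
  have "K \<subseteq> {-R..R}"
  proof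
    fix x assume "x \<in> K"
    with R have "\<bar>x\<bar> \<le> R" by blast
    then show "x \<in> {-R..R}" unfolding atLeastAtMost_iff by linarith
  qed
  moreover have "set_integrable lebesgue {-R..R} h"
    by (rule absolutely_integrable_continuous_real[OF continuous_on_subset[OF assms subset_UNIV]])
  moreover have "K \<in> sets lebesgue"
    using K by (simp add: lmeasurable_compact fmeasurableD)
  ultimately show "set_integrable lebesgue K h"
    by (blast intro: set_integrable_subset)
qed

text \<open>
  The integrand is a bump of mass \<open>H (n + 1) - H n\<close> on each \<open>{n..n + 1}\<close>, so the integral
  interpolates \<open>H\<close> at the natural numbers; no regularity of \<open>H\<close> is involved.
\<close>

lemma asymptotic_integral_representation:
  fixes H :: "real \<Rightarrow> real"
  assumes slow: "\<And>\<epsilon>. \<epsilon> > 0 \<Longrightarrow> \<forall>\<^sub>F x in at_top. \<forall>w\<in>{0..1}. \<bar>H (x + w) - H x\<bar> < \<epsilon>"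
  obtains e where "continuous_on UNIV e" "(e \<longlongrightarrow> 0) at_top"
    "((\<lambda>x. H x - oriented_integral 0 x e) \<longlongrightarrow> H 0) at_top"
proof -
  \<comment> \<open>On \<open>{0..1}\<close> this has integral 1 and vanishes at both ends, so
    scaled copies on adjacent unit intervals glue to a continuous function.\<close>
  define b :: "real \<Rightarrow> real" where "b s = max 0 (6 * s * (1 - s))" for s
  define \<delta> where "\<delta> n = H (real n + 1) - H (real n)" for n
  \<comment> \<open>For negative \<open>v\<close> the index \<open>nat \<lfloor>v\<rfloor>\<close>
    is 0 and the single term vanishes, so \<open>e\<close> is 0 there.\<close>
  define e where "e v = (\<Sum>n\<le>nat \<lfloor>v\<rfloor>. \<delta> n * b (v - real n))" for v
  have b0: "b s = 0" if "s \<le> 0 \<or> s \<ge> 1" for s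
    using that by (auto simp: b_def max_def mult_le_0_iff zero_le_mult_iff)
  have e_sum: "e v = (\<Sum>n\<le>N. \<delta> n * b (v - real n))" if "v < real N + 1" for v N
    unfolding e_def
  proof (rule sum.mono_neutral_left)
    show "{..nat \<lfloor>v\<rfloor>} \<subseteq> {..N}" using that by auto linarith
    show "\<forall>n\<in>{..N} - {..nat \<lfloor>v\<rfloor>}. \<delta> n * b (v - real n) = 0"
    proof
      fix n assume "n \<in> {..N} - {..nat \<lfloor>v\<rfloor>}"
      then have "v - real n \<le> 0" by auto linarith
      then show "\<delta> n * b (v - real n) = 0" by (simp add: b0)
    qed
  qed simp
  have e_cont: "continuous_on UNIV e"
  proof -
    have "isCont e v" for v
    proof -
      obtain N :: nat where "v < real N" using reals_Archimedean2 by blast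
      then have "\<forall>\<^sub>F w in nhds v. w < real N"
        by (intro eventually_nhds_in_open[of "{..<real N}", simplified])
      then have "\<forall>\<^sub>F w in nhds v. e w = (\<Sum>n\<le>N. \<delta> n * b (w - real n))"
        by eventually_elim (simp add: e_sum)
      moreover have "isCont (\<lambda>w. \<Sum>n\<le>N. \<delta> n * b (w - real n)) v"
        unfolding b_def by (intro continuous_intros)
      ultimately show ?thesis by (simp add: isCont_cong)
    qed
    then show ?thesis by (simp add: continuous_on_eq_continuous_at)
  qed
  have e_local: "e v = \<delta> m * (6 * (v - real m) * (1 - (v - real m)))" if "v \<in> {real m..real m + 1}" for v m
  proof -
    \<comment> \<open>The index goes up to \<open>Suc m\<close> because \<open>v\<close> may equal
      \<open>real m + 1\<close>, while \<open>e_sum\<close> asks for a strict bound.\<close>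
    have "e v = (\<Sum>n\<le>Suc m. \<delta> n * b (v - real n))"
      using that by (intro e_sum) auto
    also have "\<dots> = (\<Sum>n\<in>{m}. \<delta> n * b (v - real n))"
    proof (rule sum.mono_neutral_right)
      show "\<forall>n\<in>{..Suc m} - {m}. \<delta> n * b (v - real n) = 0"
      proof
        fix n assume "n \<in> {..Suc m} - {m}"
        then have "real n + 1 \<le> real m \<or> real n \<ge> real m + 1"
          by (cases "n < m") auto
        then show "\<delta> n * b (v - real n) = 0" using that by (auto simp: b0)
      qed
    qed auto
    also have "\<dots> = \<delta> m * b (v - real m)" by simp
    also have "b (v - real m) = 6 * (v - real m) * (1 - (v - real m))"
      using that unfolding b_def by (intro max.absorb2 mult_nonneg_nonneg) auto
    finally show ?thesis .
  qed
  define J where "J x = oriented_integral 0 x e" for x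
  note e_loc = continuous_imp_locally_integrable[OF e_cont]
  \<comment> \<open>The primitive of \<open>6 * s * (1 - s)\<close>; it increases from 0 to 1 on
    \<open>{0..1}\<close>.\<close>
  define p :: "real \<Rightarrow> real" where "p s = 3 * s\<^sup>2 - 2 * s ^ 3" for s
  have J_local: "J (real m + s) = J (real m) + \<delta> m * p s" if s: "s \<in> {0..1}" for m s
  proof -
    have "((\<lambda>v. \<delta> m * (6 * (v - real m) * (1 - (v - real m)))) has_integral
        \<delta> m * p (real m + s - real m) - \<delta> m * p (real m - real m)) {real m..real m + s}"
    proof (rule fundamental_theorem_of_calculus)
      fix v assume "v \<in> {real m..real m + s}"
      have "((\<lambda>v. \<delta> m * p (v - real m)) has_real_derivative
          \<delta> m * (6 * (v - real m) * (1 - (v - real m)))) (at v within {real m..real m + s})"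
        unfolding p_def
        by (auto intro!: derivative_eq_intros simp: algebra_simps power2_eq_square)
      then show "((\<lambda>v. \<delta> m * p (v - real m)) has_vector_derivative
          \<delta> m * (6 * (v - real m) * (1 - (v - real m)))) (at v within {real m..real m + s})"
        by (simp add: has_real_derivative_iff_has_vector_derivative)
    qed (use s in simp)
    then have "(e has_integral \<delta> m * p s) {real m..real m + s}"
      by (subst has_integral_cong[OF e_local]) (use s in \<open>auto simp: p_def\<close>)
    then have "integral {real m..real m + s} e = \<delta> m * p s"
      by (rule integral_unique)
    moreover have "oriented_integral (real m) (real m + s) e = integral {real m..real m + s} e"
      using s by (intro oriented_integral_eq_integral[OF e_loc]) simp
    ultimately show ?thesis
      using oriented_integral_combine[OF e_loc, of 0 "real m" "real m + s"] by (simp add: J_def)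
  qed
  have J_nat: "J (real m) = H (real m) - H 0" for m
  proof (induction m)
    case 0
    show ?case using oriented_integral_combine[OF e_loc, of 0 0 0] by (simp add: J_def)
  next
    case (Suc m)
    have "J (real m + 1) = J (real m) + \<delta> m * p 1" by (rule J_local) simp
    then show ?case using Suc by (simp add: \<delta>_def p_def add.commute)
  qed
  \<comment> \<open>Taking the floor loses less than 1, hence the threshold
    \<open>X + 1\<close>.\<close>
  have split: "\<exists>m s. v = real m + s \<and> s \<in> {0..1} \<and> real m \<ge> X" if "v \<ge> max 0 (X + 1)" for v X
  proof (intro exI conjI)
    show "v = real (nat \<lfloor>v\<rfloor>) + frac v" using that by (simp add: frac_def)
    show "frac v \<in> {0..1}" by (simp add: frac_lt_1 less_imp_le)
    show "real (nat \<lfloor>v\<rfloor>) \<ge> X" using that by linarith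
  qed
  have "(e \<longlongrightarrow> 0) at_top"
  proof (rule tendstoI)
    fix \<epsilon> :: real assume "\<epsilon> > 0"
    then have "\<epsilon> / 6 > 0" by simp
    from slow[OF this] obtain X where X: "\<forall>x\<ge>X. \<forall>w\<in>{0..1}. \<bar>H (x + w) - H x\<bar> < \<epsilon> / 6"
      unfolding eventually_at_top_linorder by blast
    show "\<forall>\<^sub>F v in at_top. dist (e v) 0 < \<epsilon>"
      using eventually_ge_at_top[of "max 0 (X + 1)"]
    proof eventually_elim
      case (elim v)
      obtain m s where ms: "v = real m + s" "s \<in> {0..1}" "real m \<ge> X"
        using split[OF elim] by blast
      have "\<bar>e v\<bar> = \<bar>\<delta> m\<bar> * (6 * (s * (1 - s)))"
        using e_local[of v m] ms by (simp add: abs_mult)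
      also have "\<dots> \<le> \<bar>\<delta> m\<bar> * (6 * (1 * 1))"
        using ms(2) by (intro mult_left_mono mult_mono) auto
      also have "\<bar>\<delta> m\<bar> < \<epsilon> / 6" using X[rule_format, OF ms(3), of 1] by (simp add: \<delta>_def)
      finally show ?case by (simp add: dist_real_def)
    qed
  qed
  moreover have "((\<lambda>x. H x - oriented_integral 0 x e) \<longlongrightarrow> H 0) at_top"
    unfolding J_def[symmetric]
  proof (rule tendstoI)
    fix \<epsilon> :: real assume "\<epsilon> > 0"
    then have "\<epsilon> / 2 > 0" by simp
    from slow[OF this] obtain X where X: "\<forall>x\<ge>X. \<forall>w\<in>{0..1}. \<bar>H (x + w) - H x\<bar> < \<epsilon> / 2"
      unfolding eventually_at_top_linorder by blast
    show "\<forall>\<^sub>F x in at_top. dist (H x - J x) (H 0) < \<epsilon>"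
      using eventually_ge_at_top[of "max 0 (X + 1)"]
    proof eventually_elim
      case (elim x)
      obtain m s where ms: "x = real m + s" "s \<in> {0..1}" "real m \<ge> X"
        using split[OF elim] by blast
      have p: "0 \<le> p s" "p s \<le> 1"
      proof -
        have "p s = s\<^sup>2 * (3 - 2 * s)" by (simp add: p_def algebra_simps power2_eq_square power3_eq_cube)
        then show "0 \<le> p s" using ms(2) by simp
        have "1 - p s = (1 - s)\<^sup>2 * (1 + 2 * s)"
          by (simp add: p_def algebra_simps power2_eq_square power3_eq_cube)
        then show "p s \<le> 1" using ms(2) by (smt (verit) atLeastAtMost_iff mult_nonneg_nonneg zero_le_power2)
      qed
      have "H x - J x - H 0 = (H (real m + s) - H (real m)) - \<delta> m * p s"
        using J_local[OF ms(2), of m] J_nat[of m] ms(1) by simp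
      moreover have "\<bar>H (real m + s) - H (real m)\<bar> < \<epsilon> / 2" using X ms by blast
      moreover have "\<bar>\<delta> m * p s\<bar> < \<epsilon> / 2"
      proof -
        have "\<bar>\<delta> m * p s\<bar> \<le> \<bar>\<delta> m\<bar> * 1" unfolding abs_mult using p by (intro mult_left_mono) auto
        also have "\<bar>\<delta> m\<bar> < \<epsilon> / 2" using X[rule_format, OF ms(3), of 1] by (simp add: \<delta>_def)
        finally show ?thesis by simp
      qed
      ultimately have "\<bar>H x - J x - H 0\<bar> < \<epsilon>" by linarith
      then show ?case by (simp add: dist_real_def)
    qed
  qed
  ultimately show thesis using that e_cont by blast
qed

section \<open>Increments of the integral of 1/phi and of ln f\<close>

context self_neglecting_function
begin

text \<open>Along the segment \<open>1 / \<phi>\<close> differs from \<open>1 / \<phi> x\<close> by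
  at most \<open>\<eta> / \<phi> x\<close>, and the segment has length
  \<open>\<bar>u\<bar> * \<phi> x\<close>; the factor \<open>\<phi> x\<close> cancels. So this
  integral has the limit function \<open>u\<close>, the model against which \<open>h\<close> is
  compared.\<close>

lemma integral_reciprocal_uniform:
  assumes loc: "locally_integrable (\<lambda>x. 1 / \<phi> x)" and "\<epsilon> > 0"
  shows "\<forall>\<^sub>F x in at_top. \<forall>u\<in>{-T..T}.
    \<bar>oriented_integral x (x + u * \<phi> x) (\<lambda>v. 1 / \<phi> v) - u\<bar> \<le> \<epsilon>"
proof -
  define \<eta> where "\<eta> = \<epsilon> / (\<bar>T\<bar> + 1)"
  have \<eta>: "\<eta> > 0" "\<eta> * \<bar>T\<bar> \<le> \<epsilon>" using assms(2) by (auto simp: \<eta>_def field_simps)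
  show ?thesis
    using ratio_inverse_uniform[OF \<eta>(1), of T]
  proof eventually_elim
    case (elim x)
    show ?case
    proof
      fix u assume u: "u \<in> {-T..T}"
      have "\<bar>1 / \<phi> v - 1 / \<phi> x\<bar> \<le> \<eta> / \<phi> x"
        if v: "v \<in> {min x (x + u * \<phi> x)..max x (x + u * \<phi> x)}" for v
      proof -
        define s where "s = (v - x) / \<phi> x"
        have vs: "v = x + s * \<phi> x" by (simp add: s_def)
        have "s * \<phi> x \<in> {min 0 (u * \<phi> x)..max 0 (u * \<phi> x)}"
          using v by (auto simp: vs min_def max_def split: if_splits)
        then have "0 \<le> s \<and> s \<le> u \<or> u \<le> s \<and> s \<le> 0"
          by (auto simp: min_def max_def mult_le_0_iff zero_le_mult_iff less_le_not_le
              split: if_splits)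
        then have "s \<in> {-T..T}" using u by auto
        then have "\<bar>\<phi> x / \<phi> v - 1\<bar> < \<eta>" using elim by (simp add: vs)
        then have "\<bar>\<phi> x / \<phi> v - 1\<bar> / \<phi> x \<le> \<eta> / \<phi> x"
          by (intro divide_right_mono) (auto simp: less_imp_le)
        moreover have "\<bar>\<phi> x / \<phi> v - 1\<bar> / \<phi> x = \<bar>(\<phi> x / \<phi> v - 1) / \<phi> x\<bar>"
          by (simp add: less_imp_le)
        moreover have "(\<phi> x / \<phi> v - 1) / \<phi> x = 1 / \<phi> v - 1 / \<phi> x"
          by (simp add: diff_divide_distrib)
        ultimately show ?thesis by simp
      qed
      from oriented_integral_near_constant[OF loc this, of x "x + u * \<phi> x"]
      have "\<bar>oriented_integral x (x + u * \<phi> x) (\<lambda>v. 1 / \<phi> v) - u\<bar> \<le> \<eta> / \<phi> x * \<bar>u * \<phi> x\<bar>"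
        by simp
      also have "\<dots> = \<eta> * \<bar>u\<bar>" by (simp add: abs_mult less_imp_le)
      also have "\<dots> \<le> \<eta> * \<bar>T\<bar>" using u \<eta>(1) by (intro mult_left_mono) auto
      finally show "\<bar>oriented_integral x (x + u * \<phi> x) (\<lambda>v. 1 / \<phi> v) - u\<bar> \<le> \<epsilon>"
        using \<eta>(2) by simp
    qed
  qed
qed

lemma regularly_varying_ln_incr_tendsto:
  assumes f: "\<And>x. f x > 0" "f \<in> borel_measurable lebesgue" and rv: "regularly_varying_wrt \<phi> f"
  shows "\<exists>\<gamma>. \<forall>t. ((\<lambda>x. incr (\<lambda>x. ln (f x)) x t) \<longlongrightarrow> \<gamma> t) at_top"
proof -
  obtain g where g: "\<And>t. ((\<lambda>x. f (x + t * \<phi> x) / f x) \<longlongrightarrow> g t) at_top"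
      and gpos: "{t. g t > 0} \<notin> null_sets lebesgue"
    using rv by (auto simp: regularly_varying_wrt_def)
  define h where "h = (\<lambda>x. ln (f x))"
  have h: "h \<in> borel_measurable lebesgue" unfolding h_def using f(2) by measurable
  have exp_incr: "exp (incr h x t) = f (x + t * \<phi> x) / f x" for x t
    by (simp add: incr_def h_def exp_diff f(1))
  have ln_ratio: "incr h x t = ln (f (x + t * \<phi> x) / f x)" for x t
    by (metis exp_incr ln_exp)
  have lim: "((\<lambda>x. incr h x t) \<longlongrightarrow> ln (g t)) at_top" if "g t > 0" for t
    unfolding ln_ratio using that by (intro tendsto_ln g) auto
  \<comment> \<open>Not being a null set yields positive measure only for a measurable set, so
    measurability of \<open>g\<close> is secured first, as a limit along the natural
    numbers.\<close>
  have "g \<in> borel_measurable lebesgue"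
  proof (rule borel_measurable_LIMSEQ_real)
    show "(\<lambda>n. exp (incr h (real n) t)) \<longlonglongrightarrow> g t" for t
      unfolding exp_incr using filterlim_compose[OF g filterlim_real_sequentially] .
    show "(\<lambda>t. exp (incr h (real n) t)) \<in> borel_measurable lebesgue" for n
      using borel_measurable_incr[OF h, of "real n"] by measurable
  qed
  then have "{t \<in> space lebesgue. g t > 0} \<in> sets lebesgue" by measurable
  then have A: "{t. g t > 0} \<in> sets lebesgue" by simp
  have "g t > 0" for t
  proof -
    obtain M where M: "\<forall>\<^sub>F x in at_top. \<forall>u\<in>{-\<bar>t\<bar>..\<bar>t\<bar>}. \<bar>incr h x u\<bar> \<le> M"
      by (rule incr_locally_bounded[OF h A gpos, where \<gamma> = "\<lambda>t. ln (g t)"]) (use lim in auto)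
    have "exp (- M) \<le> g t"
    proof (rule tendsto_lowerbound[OF g[of t]])
      show "\<forall>\<^sub>F x in at_top. exp (- M) \<le> f (x + t * \<phi> x) / f x"
        using M
      proof eventually_elim
        case (elim x)
        have "t \<in> {-\<bar>t\<bar>..\<bar>t\<bar>}" unfolding atLeastAtMost_iff by linarith
        from elim[rule_format, OF this] have "- M \<le> incr h x t" by linarith
        then show ?case unfolding exp_incr[symmetric] by simp
      qed
    qed simp
    then show ?thesis by (rule less_le_trans[OF exp_gt_zero])
  qed
  then have "\<forall>t. ((\<lambda>x. incr h x t) \<longlongrightarrow> ln (g t)) at_top" using lim by simp
  then show ?thesis unfolding h_def by (rule exI[of _ "\<lambda>t. ln (g t)"])
qed

end

theorem mainTheorem5:
  fixes \<phi> f :: "real \<Rightarrow> real"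
  assumes "self_neglecting \<phi>"
    and "baire_function \<phi> \<or> \<phi> \<in> borel_measurable lebesgue"
    and "eventually_bounded_away_from_0 \<phi>"
    and "locally_integrable (\<lambda>x. 1 / \<phi> x)"
    and "\<And>x. f x > 0"
    and "f \<in> borel_measurable lebesgue"
    and "regularly_varying_wrt \<phi> f"
  shows "\<exists>(\<rho> :: real) (d :: real \<Rightarrow> real) (d_lim :: real) (e :: real \<Rightarrow> real).
      d \<in> borel_measurable lebesgue \<and> d_lim > 0 \<and> (d \<longlongrightarrow> d_lim) at_top \<and>
      continuous_on UNIV e \<and> (e \<longlongrightarrow> 0) at_top \<and>
      (\<forall>x. f x = d x * exp (\<rho> * oriented_integral 1 x (\<lambda>u. 1 / \<phi> u)
                           + oriented_integral 0 x e) \<and>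
           f x = d x * exp (\<rho> * oriented_integral 1 x (\<lambda>u. (u / \<phi> u) * (1 / u))
                           + oriented_integral 0 x e)) \<and>
      (\<forall>t. ((\<lambda>x. oriented_integral x (x + t * \<phi> x) e) \<longlongrightarrow> 0) at_top)"
proof -
  interpret self_neglecting_function \<phi> by unfold_locales (rule assms(1))
  note loc = assms(4)
  define h where "h = (\<lambda>x. ln (f x))"
  have h: "h \<in> borel_measurable lebesgue" unfolding h_def using assms(6) by measurable
  obtain \<gamma> where "\<forall>t. ((\<lambda>x. incr h x t) \<longlongrightarrow> \<gamma> t) at_top"
    unfolding h_def using regularly_varying_ln_incr_tendsto[OF assms(5-7)] by blast
  then interpret convergent_increments \<phi> h \<gamma> by unfold_locales (use h in auto)
  define \<rho> where "\<rho> = \<gamma> 1"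
  define \<Phi> where "\<Phi> x = oriented_integral 1 x (\<lambda>u. 1 / \<phi> u)" for x
  define H where "H x = h x - \<rho> * \<Phi> x" for x
  have H_uniform: "\<forall>\<^sub>F x in at_top. \<forall>u\<in>{-T..T}. \<bar>incr H x u\<bar> < \<epsilon>" if "\<epsilon> > 0" for \<epsilon> T
  proof -
    define \<eta> where "\<eta> = \<epsilon> / (2 * (\<bar>\<rho>\<bar> + 1))"
    have \<eta>: "\<eta> > 0" "\<bar>\<rho>\<bar> * \<eta> \<le> \<epsilon> / 2" using that by (auto simp: \<eta>_def field_simps)
    have "\<epsilon> / 2 > 0" using that by simp
    from incr_uniform[OF this, of T] integral_reciprocal_uniform[OF loc \<eta>(1), of T]
    show ?thesis
    proof eventually_elim
      case (elim x)
      show ?case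
      proof
        fix u assume u: "u \<in> {-T..T}"
        define I where "I = oriented_integral x (x + u * \<phi> x) (\<lambda>v. 1 / \<phi> v)"
        have "\<Phi> (x + u * \<phi> x) - \<Phi> x = I"
          using oriented_integral_combine[OF loc, of 1 x "x + u * \<phi> x"] by (simp add: \<Phi>_def I_def)
        then have "\<rho> * (\<Phi> (x + u * \<phi> x) - \<Phi> x) = \<rho> * I" by simp
        then have "incr H x u = incr h x u - \<rho> * I"
          by (simp add: incr_def H_def algebra_simps)
        also have "\<dots> = (incr h x u - \<gamma> u) - \<rho> * (I - u)"
          using limit_linear[of u] by (simp add: \<rho>_def algebra_simps)
        finally have eq: "incr H x u = (incr h x u - \<gamma> u) - \<rho> * (I - u)" .
        have "\<bar>\<rho> * (I - u)\<bar> \<le> \<bar>\<rho>\<bar> * \<eta>"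
          unfolding abs_mult using elim(2) u by (intro mult_left_mono) (auto simp: I_def)
        moreover have "\<bar>incr h x u - \<gamma> u\<bar> < \<epsilon> / 2" using elim(1) u by blast
        ultimately show "\<bar>incr H x u\<bar> < \<epsilon>" using eq \<eta>(2) by linarith
      qed
    qed
  qed
  obtain K where K: "K > 0" "\<forall>\<^sub>F x in at_top. \<phi> x \<ge> K"
    using assms(3) by (auto simp: eventually_bounded_away_from_0_def eventually_at_top_linorder)
  have "\<forall>\<^sub>F x in at_top. \<forall>w\<in>{0..1}. \<bar>H (x + w) - H x\<bar> < \<epsilon>" if "\<epsilon> > 0" for \<epsilon>
    \<comment> \<open>A step \<open>w\<close> in \<open>{0..1}\<close> is
      \<open>(w / \<phi> x) * \<phi> x\<close>, and \<open>w / \<phi> x\<close> is at most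
      \<open>1 / K\<close>.\<close>
    using H_uniform[OF that, of "1 / K"] K(2)
  proof eventually_elim
    case (elim x)
    show ?case
    proof
      fix w :: real assume w: "w \<in> {0..1}"
      have "w / \<phi> x \<le> 1 / K" using w elim(2) K(1) by (intro frac_le) auto
      moreover have "0 \<le> w / \<phi> x" "- (1 / K) \<le> 0" using w K(1) by (auto simp: less_imp_le)
      ultimately have "w / \<phi> x \<in> {-(1 / K)..1 / K}" by auto
      from elim(1)[rule_format, OF this] show "\<bar>H (x + w) - H x\<bar> < \<epsilon>"
        by (simp add: incr_def)
    qed
  qed
  then obtain e where e: "continuous_on UNIV e" "(e \<longlongrightarrow> 0) at_top"
    and lim: "((\<lambda>x. H x - oriented_integral 0 x e) \<longlongrightarrow> H 0) at_top"
    by (rule asymptotic_integral_representation)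
  note e_loc = continuous_imp_locally_integrable[OF e(1)]
  define J where "J x = oriented_integral 0 x e" for x
  \<comment> \<open>This makes the representation an exact identity at every \<open>x\<close>; the
    limit of \<open>d\<close> is \<open>exp (H 0)\<close> since \<open>H x - J x\<close> tends to
    \<open>H 0\<close>.\<close>
  define d where "d x = exp (H x - J x)" for x
  have "d \<in> borel_measurable lebesgue"
  proof -
    have "continuous_on UNIV \<Phi>" "continuous_on UNIV J"
      unfolding \<Phi>_def[abs_def] J_def[abs_def] continuous_on_eq_continuous_at[OF open_UNIV]
      by (auto intro: isCont_oriented_integral loc e_loc)
    then have "\<Phi> \<in> borel_measurable lborel" "J \<in> borel_measurable lborel"
      by (simp_all add: borel_measurable_continuous_onI)
    then have "\<Phi> \<in> borel_measurable lebesgue" "J \<in> borel_measurable lebesgue"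
      by (simp_all only: measurable_completion)
    then show ?thesis unfolding d_def[abs_def] H_def using h by measurable
  qed
  moreover have "exp (H 0) > 0" by simp
  moreover have "(d \<longlongrightarrow> exp (H 0)) at_top"
    unfolding d_def J_def using lim by (rule tendsto_exp)
  moreover have f_eq: "f x = d x * exp (\<rho> * \<Phi> x + J x)" for x
    by (simp add: d_def H_def h_def assms(5) flip: exp_add)
  moreover have "oriented_integral 1 x (\<lambda>u. (u / \<phi> u) * (1 / u)) = \<Phi> x" for x
  proof -
    \<comment> \<open>The two integrands differ only at \<open>u = 0\<close>, where division by zero
      gives 0 instead of \<open>1 / \<phi> 0\<close>; one point is negligible.\<close>
    have loc': "locally_integrable (\<lambda>u. (u / \<phi> u) * (1 / u))"
      unfolding locally_integrable_def
    proof (intro allI impI)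
      fix C :: "real set" assume "compact C"
      then have "(\<lambda>u. 1 / \<phi> u) absolutely_integrable_on C" using loc by (simp add: locally_integrable_def)
      then show "(\<lambda>u. (u / \<phi> u) * (1 / u)) absolutely_integrable_on C"
        by (rule absolutely_integrable_spike[OF _ negligible_sing[of 0]]) auto
    qed
    have "integral S (\<lambda>u. (u / \<phi> u) * (1 / u)) = integral S (\<lambda>u. 1 / \<phi> u)" for S
      by (rule integral_spike[OF negligible_sing[of 0]]) auto
    moreover have "1 \<in> {-(\<bar>x\<bar> + 1)..\<bar>x\<bar> + 1}" "x \<in> {-(\<bar>x\<bar> + 1)..\<bar>x\<bar> + 1}"
      unfolding atLeastAtMost_iff by linarith+
    ultimately show ?thesis
      unfolding \<Phi>_def
      by (simp only: oriented_integral_eq_diff[OF loc', of 1 "\<bar>x\<bar> + 1" x]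
          oriented_integral_eq_diff[OF loc, of 1 "\<bar>x\<bar> + 1" x])
  qed
  moreover have "((\<lambda>x. oriented_integral x (x + t * \<phi> x) e) \<longlongrightarrow> 0) at_top" for t
  proof -
    have t: "t \<in> {-\<bar>t\<bar>..\<bar>t\<bar>}" unfolding atLeastAtMost_iff by linarith
    have shift: "filterlim (\<lambda>x. x + t * \<phi> x) at_top at_top"
      unfolding filterlim_at_top
    proof
      fix Z :: real
      from eventually_shift[OF eventually_ge_at_top[of Z], of "\<bar>t\<bar>"]
      show "\<forall>\<^sub>F x in at_top. Z \<le> x + t * \<phi> x"
        by eventually_elim (use t in blast)
    qed
    have "((\<lambda>x. incr H x t) \<longlongrightarrow> 0) at_top"
    proof (rule tendstoI)
      fix \<epsilon> :: real assume "\<epsilon> > 0"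
      from H_uniform[OF this, of "\<bar>t\<bar>"] show "\<forall>\<^sub>F x in at_top. dist (incr H x t) 0 < \<epsilon>"
        by eventually_elim (use t in \<open>simp add: dist_real_def\<close>)
    qed
    \<comment> \<open>The increment of \<open>J\<close> is that of \<open>H\<close> minus that of
      \<open>H - J\<close>; the former tends to 0, and so does the latter because
      \<open>H - J\<close> converges.\<close>
    from tendsto_add[OF tendsto_diff[OF this filterlim_compose[OF lim shift]] lim]
    have "((\<lambda>x. incr H x t - (H (x + t * \<phi> x) - J (x + t * \<phi> x)) + (H x - J x)) \<longlongrightarrow> 0) at_top"
      by (simp add: J_def)
    moreover have "incr H x t - (H (x + t * \<phi> x) - J (x + t * \<phi> x)) + (H x - J x)
        = oriented_integral x (x + t * \<phi> x) e" for x
      using oriented_integral_combine[OF e_loc, of 0 x "x + t * \<phi> x"] by (simp add: incr_def J_def)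
    ultimately show ?thesis by simp
  qed
  ultimately show ?thesis
    using e unfolding \<Phi>_def J_def
    by (intro exI[of _ \<rho>] exI[of _ d] exI[of _ "exp (H 0)"] exI[of _ e]) auto
qed

end
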